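(* Let $\mathcal{C}$ be a triangulated category with a maximal 1-orthogonal object $T$. Let $M$ be an indecomposable object in $\mathcal{C}$ which does not belong to $\mathrm{add}\, T[1]$. Then the $\mathrm{End}_{\mathcal{C}}(T)$-module $\mathrm{Hom}_{\mathcal{C}}(T,M)$ has infinite projective dimension if and only if the factorization ideal $I_M$ is non-zero.
   Context: For an object $T$ of a triangulated category $\mathcal{C}$ with shift $[1]$, $\mathrm{add}\, T$ denotes the full subcategory of direct summands of finite direct sums of copies of $T$, and $\mathrm{Ext}^1_{\mathcal{C}}(X,Y)=\mathrm{Hom}_{\mathcal{C}}(X,Y[1])$. The object $T$ is called maximal 1-orthogonal if $\mathrm{add}\, T$ is contravariantly finite and covariantly finite in $\mathcal{C}$, and an object $X\in\mathcal{C}$ belongs to $\mathrm{add}\, T$ if and only if $\mathrm{Ext}^1_{\mathcal{C}}(X,T)=0=\mathrm{Ext}^1_{\mathcal{C}}(T,X)$. Put $C=\mathrm{End}_{\mathcal{C}}(T)$; projective dimension is taken in the category $\mathrm{mod}\, C$ of finitely presented $C$-modules. The functor $\mathrm{Hom}_{\mathcal{C}}(T,-)$ induces an equivalence $\mathcal{C}/\mathrm{add}\, T[1]\to \mathrm{mod}\, C$ (a known result of Koenig and Zhu), under which the projective $C$-modules are those of the form $\mathrm{Hom}_{\mathcal{C}}(T,T^0)$ with $T^0\in\mathrm{add}\, T$. The factorization ideal $I_M$ of an object $M$ is the ideal of $\mathrm{End}_{\mathcal{C}}(T[1])$ consisting of all $f$ for which there exist morphisms $g:T[1]\to M$ and $h:M\to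 T[1]$ with $f=h\circ g$.
   Formalization: Idempotent endomorphisms of objects of add T are assumed to split, and maximal 1-orthogonal means that Ext^1(X,T)=0 and Ext^1(T,X)=0 each separately characterise X in add T; without either the claim fails, and both follow from the Koenig–Zhu facts in the context. *)

theory Defs
  imports "HOL-Algebra.Module" "HOL-Library.FuncSet" "HOL-Library.Extended_Nat"
begin

section \<open>Additive categories\<close>

text \<open>Every arrow has one domain and one codomain, so hom-sets are disjoint. \<open>g \<cdot> f\<close> is
  ``first \<open>f\<close>, then \<open>g\<close>''. \<open>Add\<close> is only meaningful on parallel arrows.\<close>

record ('o, 'a) add_cat =
  Ob :: "'o set"
  Arr :: "'a set"
  Dom :: "'a \<Rightarrow> 'o"
  Cod :: "'a \<Rightarrow> 'o"
  Id :: "'o \<Rightarrow> 'a"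
  Comp :: "'a \<Rightarrow> 'a \<Rightarrow> 'a"  (infixl \<open>\<cdot>\<index>\<close> 70)
  Add :: "'a \<Rightarrow> 'a \<Rightarrow> 'a"
  Zer :: "'o \<Rightarrow> 'o \<Rightarrow> 'a"

definition Hom :: "('o, 'a, 'm) add_cat_scheme \<Rightarrow> 'o \<Rightarrow> 'o \<Rightarrow> 'a set"
  where "Hom C X Y = {f \<in> Arr C. Dom C f = X \<and> Cod C f = Y}"

definition hom_group :: "('o, 'a, 'm) add_cat_scheme \<Rightarrow> 'o \<Rightarrow> 'o \<Rightarrow> 'a monoid"
  where "hom_group C X Y = \<lparr>carrier = Hom C X Y, monoid.mult = Add C, one = Zer C X Y\<rparr>"

definition Neg :: "('o, 'a, 'm) add_cat_scheme \<Rightarrow> 'a \<Rightarrow> 'a"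
  where "Neg C f = m_inv (hom_group C (Dom C f) (Cod C f)) f"

definition zero_object :: "('o, 'a, 'm) add_cat_scheme \<Rightarrow> 'o \<Rightarrow> bool"
  where "zero_object C Z \<longleftrightarrow> Z \<in> Ob C \<and> Id C Z = Zer C Z Z"

definition iso_arrow :: "('o, 'a, 'm) add_cat_scheme \<Rightarrow> 'o \<Rightarrow> 'o \<Rightarrow> 'a \<Rightarrow> bool"
  where "iso_arrow C X Y f \<longleftrightarrow>
    f \<in> Hom C X Y \<and> (\<exists>g \<in> Hom C Y X. g \<cdot>\<^bsub>C\<^esub> f = Id C X \<and> f \<cdot>\<^bsub>C\<^esub> g = Id C Y)"

text \<open>\<open>Z\<close> is a direct sum (biproduct) of \<open>X\<close> and \<open>Y\<close>.\<close>

definition direct_sum :: "('o, 'a, 'm) add_cat_scheme \<Rightarrow> 'o \<Rightarrow> 'o \<Rightarrow> 'o \<Rightarrow> bool"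
  where "direct_sum C Z X Y \<longleftrightarrow>
    X \<in> Ob C \<and> Y \<in> Ob C \<and> Z \<in> Ob C \<and>
    (\<exists>i1 \<in> Hom C X Z. \<exists>i2 \<in> Hom C Y Z. \<exists>p1 \<in> Hom C Z X. \<exists>p2 \<in> Hom C Z Y.
       p1 \<cdot>\<^bsub>C\<^esub> i1 = Id C X \<and> p2 \<cdot>\<^bsub>C\<^esub> i2 = Id C Y \<and>
       p1 \<cdot>\<^bsub>C\<^esub> i2 = Zer C Y X \<and> p2 \<cdot>\<^bsub>C\<^esub> i1 = Zer C X Y \<and>
       Add C (i1 \<cdot>\<^bsub>C\<^esub> p1) (i2 \<cdot>\<^bsub>C\<^esub> p2) = Id C Z)"

locale additive_category =
  fixes C :: "('o, 'a, 'm) add_cat_scheme" (structure)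
  assumes Dom_in: "f \<in> Arr C \<Longrightarrow> Dom C f \<in> Ob C"
    and Cod_in: "f \<in> Arr C \<Longrightarrow> Cod C f \<in> Ob C"
    and Id_in: "X \<in> Ob C \<Longrightarrow> Id C X \<in> Hom C X X"
    and Comp_in: "f \<in> Hom C X Y \<Longrightarrow> g \<in> Hom C Y Z \<Longrightarrow> g \<cdot> f \<in> Hom C X Z"
    and Comp_Id: "f \<in> Hom C X Y \<Longrightarrow> f \<cdot> Id C X = f"
    and Id_Comp: "f \<in> Hom C X Y \<Longrightarrow> Id C Y \<cdot> f = f"
    and Comp_assoc: "f \<in> Hom C W X \<Longrightarrow> g \<in> Hom C X Y \<Longrightarrow> h \<in> Hom C Y Z \<Longrightarrow>
      (h \<cdot> g) \<cdot> f = h \<cdot> (g \<cdot> f)"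
    and hom_group: "X \<in> Ob C \<Longrightarrow> Y \<in> Ob C \<Longrightarrow> comm_group (hom_group C X Y)"
    and Comp_Add: "f \<in> Hom C X Y \<Longrightarrow> f' \<in> Hom C X Y \<Longrightarrow> g \<in> Hom C Y Z \<Longrightarrow>
      g \<cdot> Add C f f' = Add C (g \<cdot> f) (g \<cdot> f')"
    and Add_Comp: "f \<in> Hom C X Y \<Longrightarrow> g \<in> Hom C Y Z \<Longrightarrow> g' \<in> Hom C Y Z \<Longrightarrow>
      Add C g g' \<cdot> f = Add C (g \<cdot> f) (g' \<cdot> f)"
    and ex_zero_object: "\<exists>Z. zero_object C Z"
    and ex_direct_sum: "X \<in> Ob C \<Longrightarrow> Y \<in> Ob C \<Longrightarrow> \<exists>Z. direct_sum C Z X Y"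

definition indecomposable :: "('o, 'a, 'm) add_cat_scheme \<Rightarrow> 'o \<Rightarrow> bool"
  where "indecomposable C M \<longleftrightarrow> M \<in> Ob C \<and> \<not> zero_object C M \<and>
    (\<forall>X Y. direct_sum C M X Y \<longrightarrow> zero_object C X \<or> zero_object C Y)"

primrec copies :: "('o, 'a, 'm) add_cat_scheme \<Rightarrow> 'o \<Rightarrow> nat \<Rightarrow> 'o \<Rightarrow> bool"
  where
    "copies C T 0 Z \<longleftrightarrow> zero_object C Z"
  | "copies C T (Suc n) Z \<longleftrightarrow> (\<exists>W. copies C T n W \<and> direct_sum C Z W T)"

definition add_obj :: "('o, 'a, 'm) add_cat_scheme \<Rightarrow> 'o \<Rightarrow> 'o set"
  where "add_obj C T = {X. \<exists>n Z Y. copies C T n Z \<and> direct_sum C Z X Y}"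

definition contravariantly_finite :: "('o, 'a, 'm) add_cat_scheme \<Rightarrow> 'o set \<Rightarrow> bool"
  where "contravariantly_finite C S \<longleftrightarrow>
    (\<forall>X \<in> Ob C. \<exists>S0 \<in> S. \<exists>f \<in> Hom C S0 X.
       \<forall>S1 \<in> S. \<forall>g \<in> Hom C S1 X. \<exists>h \<in> Hom C S1 S0. g = f \<cdot>\<^bsub>C\<^esub> h)"

definition covariantly_finite :: "('o, 'a, 'm) add_cat_scheme \<Rightarrow> 'o set \<Rightarrow> bool"
  where "covariantly_finite C S \<longleftrightarrow>
    (\<forall>X \<in> Ob C. \<exists>S0 \<in> S. \<exists>f \<in> Hom C X S0.
       \<forall>S1 \<in> S. \<forall>g \<in> Hom C X S1. \<exists>h \<in> Hom C S0 S1. g = h \<cdot>\<^bsub>C\<^esub> f)"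

text \<open>For \<open>S = add T\<close> this says that every finitely generated projective \<open>End T\<close>-module has the
  form \<open>Hom(T, T')\<close> with \<open>T'\<close> in \<open>add T\<close>; it holds in every Krull--Schmidt category, but not in
  every triangulated category (for example, a dense triangulated subcategory).\<close>

definition idempotents_split_on :: "('o, 'a, 'm) add_cat_scheme \<Rightarrow> 'o set \<Rightarrow> bool"
  where "idempotents_split_on C S \<longleftrightarrow>
    (\<forall>X \<in> S. \<forall>e \<in> Hom C X X. e \<cdot>\<^bsub>C\<^esub> e = e \<longrightarrow>
       (\<exists>Y \<in> Ob C. \<exists>r \<in> Hom C X Y. \<exists>s \<in> Hom C Y X. r \<cdot>\<^bsub>C\<^esub> s = Id C Y \<and> s \<cdot>\<^bsub>C\<^esub> r = e))"


section \<open>Triangulated categories\<close>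

text \<open>\<open>ShO\<close> and \<open>ShA\<close> are the shift on objects and on arrows. \<open>(u, v, w) \<in> Tri\<close> stands for the
  distinguished triangle \<open>X \<rightarrow> Y \<rightarrow> Z \<rightarrow> X[1]\<close> with these maps; the objects are recovered from
  the arrows.\<close>

record ('o, 'a) tri_cat = "('o, 'a) add_cat" +
  ShO :: "'o \<Rightarrow> 'o"
  ShA :: "'a \<Rightarrow> 'a"
  Tri :: "('a \<times> 'a \<times> 'a) set"

definition triangle ::
  "('o, 'a, 'm) tri_cat_scheme \<Rightarrow> 'o \<Rightarrow> 'o \<Rightarrow> 'o \<Rightarrow> 'a \<Rightarrow> 'a \<Rightarrow> 'a \<Rightarrow> bool"
  where "triangle C X Y Z u v w \<longleftrightarrow> X \<in> Ob C \<and> Y \<in> Ob C \<and> Z \<in> Ob C \<and>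
    u \<in> Hom C X Y \<and> v \<in> Hom C Y Z \<and> w \<in> Hom C Z (ShO C X)"

definition dist_triangle ::
  "('o, 'a, 'm) tri_cat_scheme \<Rightarrow> 'o \<Rightarrow> 'o \<Rightarrow> 'o \<Rightarrow> 'a \<Rightarrow> 'a \<Rightarrow> 'a \<Rightarrow> bool"
  where "dist_triangle C X Y Z u v w \<longleftrightarrow> triangle C X Y Z u v w \<and> (u, v, w) \<in> Tri C"

text \<open>The shift is an additive autoequivalence (an automorphism is a special case).\<close>

locale triangulated_category = additive_category C
  for C :: "('o, 'a, 'm) tri_cat_scheme" (structure) +
  assumes ShO_in: "X \<in> Ob C \<Longrightarrow> ShO C X \<in> Ob C"
    and ShA_Id: "X \<in> Ob C \<Longrightarrow> ShA C (Id C X) = Id C (ShO C X)"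
    and ShA_Comp: "f \<in> Hom C X Y \<Longrightarrow> g \<in> Hom C Y Z \<Longrightarrow> ShA C (g \<cdot> f) = ShA C g \<cdot> ShA C f"
    and ShA_Add: "f \<in> Hom C X Y \<Longrightarrow> g \<in> Hom C X Y \<Longrightarrow>
      ShA C (Add C f g) = Add C (ShA C f) (ShA C g)"
    and ShA_bij: "X \<in> Ob C \<Longrightarrow> Y \<in> Ob C \<Longrightarrow>
      bij_betw (ShA C) (Hom C X Y) (Hom C (ShO C X) (ShO C Y))"
    and ShO_dense: "Y \<in> Ob C \<Longrightarrow> \<exists>X \<in> Ob C. \<exists>f. iso_arrow C (ShO C X) Y f"
    and TR1_Id: "X \<in> Ob C \<Longrightarrow> zero_object C Z \<Longrightarrow>
      dist_triangle C X X Z (Id C X) (Zer C X Z) (Zer C Z (ShO C X))"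
    and TR1_iso: "dist_triangle C X Y Z u v w \<Longrightarrow> triangle C X' Y' Z' u' v' w' \<Longrightarrow>
      iso_arrow C X X' a \<Longrightarrow> iso_arrow C Y Y' b \<Longrightarrow> iso_arrow C Z Z' c \<Longrightarrow>
      b \<cdot> u = u' \<cdot> a \<Longrightarrow> c \<cdot> v = v' \<cdot> b \<Longrightarrow> ShA C a \<cdot> w = w' \<cdot> c \<Longrightarrow>
      dist_triangle C X' Y' Z' u' v' w'"
    and TR1_cone: "X \<in> Ob C \<Longrightarrow> Y \<in> Ob C \<Longrightarrow> u \<in> Hom C X Y \<Longrightarrow>
      \<exists>Z v w. dist_triangle C X Y Z u v w"
    and TR2: "triangle C X Y Z u v w \<Longrightarrow>
      dist_triangle C X Y Z u v w \<longleftrightarrow> dist_triangle C Y Z (ShO C X) v w (Neg C (ShA C u))"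
    and TR3: "dist_triangle C X Y Z u v w \<Longrightarrow> dist_triangle C X' Y' Z' u' v' w' \<Longrightarrow>
      a \<in> Hom C X X' \<Longrightarrow> b \<in> Hom C Y Y' \<Longrightarrow> b \<cdot> u = u' \<cdot> a \<Longrightarrow>
      \<exists>c \<in> Hom C Z Z'. c \<cdot> v = v' \<cdot> b \<and> ShA C a \<cdot> w = w' \<cdot> c"
    and TR4: "dist_triangle C X Y Z' u i i' \<Longrightarrow> dist_triangle C Y Z X' v j j' \<Longrightarrow>
      dist_triangle C X Z Y' (v \<cdot> u) k k' \<Longrightarrow>
      \<exists>f g. dist_triangle C Z' Y' X' f g (ShA C i \<cdot> j') \<and>
        f \<cdot> i = k \<cdot> v \<and> k' \<cdot> f = i' \<and> g \<cdot> k = j \<and> j' \<cdot> g = ShA C u \<cdot> k'"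

definition Ext1 :: "('o, 'a, 'm) tri_cat_scheme \<Rightarrow> 'o \<Rightarrow> 'o \<Rightarrow> 'a set"
  where "Ext1 C X Y = Hom C X (ShO C Y)"

definition Ext1_vanishes :: "('o, 'a, 'm) tri_cat_scheme \<Rightarrow> 'o \<Rightarrow> 'o \<Rightarrow> bool"
  where "Ext1_vanishes C X Y \<longleftrightarrow> Ext1 C X Y = {Zer C X (ShO C Y)}"

text \<open>Following Iyama and Koenig--Zhu, each of the two vanishing conditions separately
  characterises membership in \<open>add T\<close>. With the weaker reading (membership is equivalent to
  both vanishing together) the Koenig--Zhu equivalence fails: in the stable category of the
  self-injective Nakayama algebra with 3 simples and Loewy length 5 there are \<open>T\<close> satisfying
  the weak condition and \<open>X\<close> outside \<open>add T\<close> with \<open>Hom(T, X[1]) = 0\<close>.\<close>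

definition maximal_1_orthogonal :: "('o, 'a, 'm) tri_cat_scheme \<Rightarrow> 'o \<Rightarrow> bool"
  where "maximal_1_orthogonal C T \<longleftrightarrow> T \<in> Ob C \<and>
    contravariantly_finite C (add_obj C T) \<and> covariantly_finite C (add_obj C T) \<and>
    (\<forall>X \<in> Ob C. (X \<in> add_obj C T \<longleftrightarrow> Ext1_vanishes C X T) \<and>
                 (X \<in> add_obj C T \<longleftrightarrow> Ext1_vanishes C T X))"

definition factorization_ideal :: "('o, 'a, 'm) tri_cat_scheme \<Rightarrow> 'o \<Rightarrow> 'o \<Rightarrow> 'a set"
  where "factorization_ideal C T M =
    {f \<in> Hom C (ShO C T) (ShO C T).
       \<exists>g \<in> Hom C (ShO C T) M. \<exists>h \<in> Hom C M (ShO C T). f = h \<cdot>\<^bsub>C\<^esub> g}"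


section \<open>Right modules and projective dimension\<close>

text \<open>Modules over \<open>End T\<close> are right modules: \<open>Hom(T, M)\<close> is acted on by precomposition. The
  library's \<open>module\<close> record is used with \<open>r \<odot> x\<close> standing for \<open>x r\<close>, which is why
  \<open>smult_assoc\<close> reverses the order. The fields \<open>mult\<close> and \<open>one\<close> of that record carry no
  meaning for a module. (The library's \<open>module\<close> locale is about commutative rings.)\<close>

locale right_module = R?: ring R + M?: abelian_group M
  for R :: "('r, 'k) ring_scheme" (structure) and M :: "('r, 'x, 'l) module_scheme" (structure) +
  assumes smult_closed: "r \<in> carrier R \<Longrightarrow> x \<in> carrier M \<Longrightarrow> r \<odot>\<^bsub>M\<^esub> x \<in> carrier M"
    and smult_l_distr: "r \<in> carrier R \<Longrightarrow> s \<in> carrier R \<Longrightarrow> x \<in> carrier M \<Longrightarrow>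
      (r \<oplus>\<^bsub>R\<^esub> s) \<odot>\<^bsub>M\<^esub> x = r \<odot>\<^bsub>M\<^esub> x \<oplus>\<^bsub>M\<^esub> s \<odot>\<^bsub>M\<^esub> x"
    and smult_r_distr: "r \<in> carrier R \<Longrightarrow> x \<in> carrier M \<Longrightarrow> y \<in> carrier M \<Longrightarrow>
      r \<odot>\<^bsub>M\<^esub> (x \<oplus>\<^bsub>M\<^esub> y) = r \<odot>\<^bsub>M\<^esub> x \<oplus>\<^bsub>M\<^esub> r \<odot>\<^bsub>M\<^esub> y"
    and smult_assoc: "r \<in> carrier R \<Longrightarrow> s \<in> carrier R \<Longrightarrow> x \<in> carrier M \<Longrightarrow>
      (r \<otimes>\<^bsub>R\<^esub> s) \<odot>\<^bsub>M\<^esub> x = s \<odot>\<^bsub>M\<^esub> (r \<odot>\<^bsub>M\<^esub> x)"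
    and smult_one: "x \<in> carrier M \<Longrightarrow> \<one>\<^bsub>R\<^esub> \<odot>\<^bsub>M\<^esub> x = x"

definition rmod_hom ::
  "('r, 'k) ring_scheme \<Rightarrow> ('r, 'x, 'l) module_scheme \<Rightarrow> ('r, 'y, 'm) module_scheme \<Rightarrow> ('x \<Rightarrow> 'y) set"
  where "rmod_hom R A B =
    {f \<in> carrier A \<rightarrow> carrier B.
       (\<forall>x \<in> carrier A. \<forall>y \<in> carrier A. f (x \<oplus>\<^bsub>A\<^esub> y) = f x \<oplus>\<^bsub>B\<^esub> f y) \<and>
       (\<forall>r \<in> carrier R. \<forall>x \<in> carrier A. f (r \<odot>\<^bsub>A\<^esub> x) = r \<odot>\<^bsub>B\<^esub> f x)}"

definition ker_on :: "('r, 'x, 'l) module_scheme \<Rightarrow> ('r, 'y, 'm) module_scheme \<Rightarrow> ('x \<Rightarrow> 'y) \<Rightarrow> 'x set"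
  where "ker_on A B f = {x \<in> carrier A. f x = \<zero>\<^bsub>B\<^esub>}"

definition free_rmod :: "('r, 'k) ring_scheme \<Rightarrow> nat \<Rightarrow> ('r, nat \<Rightarrow> 'r) module"
  where "free_rmod R n =
    \<lparr>carrier = {..<n} \<rightarrow>\<^sub>E carrier R, monoid.mult = undefined, one = undefined,
     zero = (\<lambda>i \<in> {..<n}. \<zero>\<^bsub>R\<^esub>), add = (\<lambda>x y. \<lambda>i \<in> {..<n}. x i \<oplus>\<^bsub>R\<^esub> y i),
     smult = (\<lambda>r x. \<lambda>i \<in> {..<n}. x i \<otimes>\<^bsub>R\<^esub> r)\<rparr>"

definition finitely_presented ::
  "('r, 'k) ring_scheme \<Rightarrow> ('r, 'x, 'l) module_scheme \<Rightarrow> bool"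
  where "finitely_presented R N \<longleftrightarrow> right_module R N \<and>
    (\<exists>m n. \<exists>q \<in> rmod_hom R (free_rmod R m) (free_rmod R n). \<exists>p \<in> rmod_hom R (free_rmod R n) N.
       p ` carrier (free_rmod R n) = carrier N \<and>
       ker_on (free_rmod R n) N p = q ` carrier (free_rmod R m))"

text \<open>A set-sized copy of the category \<open>mod R\<close>: a finitely presented module is isomorphic to a
  quotient of some \<open>R\<^sup>n\<close>, whose elements are cosets, that is, sets of functions
  \<open>nat \<Rightarrow> 'r\<close>. So restricting the carrier type loses nothing up to isomorphism. The
  epimorphisms of \<open>mod R\<close> are the surjective homomorphisms.\<close>

definition mod_fp :: "('r, 'k) ring_scheme \<Rightarrow> ('r, (nat \<Rightarrow> 'r) set) module set"
  where "mod_fp R = {N. finitely_presented R N}"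

definition projective_in_mod :: "('r, 'k) ring_scheme \<Rightarrow> ('r, (nat \<Rightarrow> 'r) set) module \<Rightarrow> bool"
  where "projective_in_mod R P \<longleftrightarrow> P \<in> mod_fp R \<and>
    (\<forall>A \<in> mod_fp R. \<forall>B \<in> mod_fp R. \<forall>e \<in> rmod_hom R A B. \<forall>f \<in> rmod_hom R P B.
       e ` carrier A = carrier B \<longrightarrow>
       (\<exists>g \<in> rmod_hom R P A. \<forall>x \<in> carrier P. e (g x) = f x))"

text \<open>\<open>\<dots> \<rightarrow> P 1 \<rightarrow> P 0 \<rightarrow> N \<rightarrow> 0\<close> is a projective resolution in \<open>mod R\<close>, with augmentation \<open>\<epsilon>\<close>
  and differentials \<open>d i : P (i + 1) \<rightarrow> P i\<close>, and \<open>P i = 0\<close> for \<open>i > n\<close>.\<close>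

definition proj_resolution ::
  "('r, 'k) ring_scheme \<Rightarrow> ('r, 'x, 'l) module_scheme \<Rightarrow> nat \<Rightarrow>
   (nat \<Rightarrow> ('r, (nat \<Rightarrow> 'r) set) module) \<Rightarrow>
   (nat \<Rightarrow> (nat \<Rightarrow> 'r) set \<Rightarrow> (nat \<Rightarrow> 'r) set) \<Rightarrow> ((nat \<Rightarrow> 'r) set \<Rightarrow> 'x) \<Rightarrow> bool"
  where "proj_resolution R N n P d \<epsilon> \<longleftrightarrow>
    (\<forall>i. projective_in_mod R (P i)) \<and>
    (\<forall>i. d i \<in> rmod_hom R (P (Suc i)) (P i)) \<and>
    \<epsilon> \<in> rmod_hom R (P 0) N \<and>
    \<epsilon> ` carrier (P 0) = carrier N \<and>
    ker_on (P 0) N \<epsilon> = d 0 ` carrier (P 1) \<and>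
    (\<forall>i. ker_on (P (Suc i)) (P i) (d i) = d (Suc i) ` carrier (P (Suc (Suc i)))) \<and>
    (\<forall>i > n. carrier (P i) = {\<zero>\<^bsub>P i\<^esub>})"

text \<open>The infimum of the empty set is \<open>\<infinity>\<close>; the zero module gets dimension 0.\<close>

definition proj_dim :: "('r, 'k) ring_scheme \<Rightarrow> ('r, 'x, 'l) module_scheme \<Rightarrow> enat"
  where "proj_dim R N = (INF n \<in> {n. \<exists>P d \<epsilon>. proj_resolution R N n P d \<epsilon>}. enat n)"


section \<open>The endomorphism ring and the modules \<open>Hom(T, M)\<close>\<close>

definition End_ring :: "('o, 'a, 'm) add_cat_scheme \<Rightarrow> 'o \<Rightarrow> 'a ring"
  where "End_ring C T =
    \<lparr>carrier = Hom C T T, monoid.mult = Comp C, one = Id C T, zero = Zer C T T, add = Add C\<rparr>"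

definition Hom_module :: "('o, 'a, 'm) add_cat_scheme \<Rightarrow> 'o \<Rightarrow> 'o \<Rightarrow> ('a, 'a) module"
  where "Hom_module C T M =
    \<lparr>carrier = Hom C T M, monoid.mult = undefined, one = undefined,
     zero = Zer C T M, add = Add C, smult = (\<lambda>c f. f \<cdot>\<^bsub>C\<^esub> c)\<rparr>"

lemma (in additive_category) abelian_group_hom:
  assumes "X \<in> Ob C" "Y \<in> Ob C" and "carrier R = Hom C X Y" "add R = Add C" "zero R = Zer C X Y"
  shows "abelian_group R"
proof -
  interpret H: comm_group "hom_group C X Y"
    using hom_group[OF assms(1,2)] .
  show ?thesis
  proof (rule abelian_groupI)
    fix x assume "x \<in> carrier R"
    then have "x \<in> carrier (hom_group C X Y)"
      using assms by (simp add: hom_group_def)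
    from H.l_inv_ex[OF this] show "\<exists>y \<in> carrier R. y \<oplus>\<^bsub>R\<^esub> x = \<zero>\<^bsub>R\<^esub>"
      using assms by (simp add: hom_group_def)
  qed (use assms H.m_closed H.one_closed H.m_assoc H.m_comm H.l_one in
       \<open>simp_all add: hom_group_def\<close>)
qed

lemma (in additive_category) ring_End_ring:
  assumes "T \<in> Ob C"
  shows "ring (End_ring C T)"
proof -
  have "abelian_group (End_ring C T)"
    by (rule abelian_group_hom[OF assms assms]) (simp_all add: End_ring_def)
  moreover have "monoid (End_ring C T)"
    using assms
    by unfold_locales (auto simp: End_ring_def intro: Comp_in Id_in Comp_Id Id_Comp Comp_assoc)
  ultimately show ?thesis
    by (intro ring.intro ring_axioms.intro) (auto simp: End_ring_def intro: Comp_Add Add_Comp)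
qed

lemma (in additive_category) right_module_Hom_module:
  assumes "T \<in> Ob C" "M \<in> Ob C"
  shows "right_module (End_ring C T) (Hom_module C T M)"
proof -
  have "abelian_group (Hom_module C T M)"
    by (rule abelian_group_hom[OF assms]) (simp_all add: Hom_module_def)
  then show ?thesis
    by (intro right_module.intro right_module_axioms.intro ring_End_ring assms)
       (auto simp: Hom_module_def End_ring_def
         intro: Comp_in Comp_Add Add_Comp Comp_Id Comp_assoc[symmetric])
qed

end

theory Submission
  imports Defs
begin

text \<open>
  Write \<open>F = Hom(T, _)\<close> and choose a triangle \<open>K \<rightarrow> T0 \<rightarrow> M \<rightarrow> K[1]\<close> with \<open>T0 \<rightarrow> M\<close> surjective under
  \<open>F\<close>; then \<open>K\<close> is in \<open>add T\<close>. The kernel of \<open>F K \<rightarrow> F T0\<close> consists of the maps \<open>T \<rightarrow> K\<close> whose shift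
  factors as \<open>T[1] \<rightarrow> M \<rightarrow> K[1]\<close>, and every map \<open>M \<rightarrow> T[1]\<close> factors through \<open>M \<rightarrow> K[1]\<close>, so the
  kernel is zero iff \<open>I_M = 0\<close>. If it is zero, \<open>F M\<close> has projective dimension at most 1.
  Conversely, a finite projective resolution of \<open>F M\<close> lifts to a complex in \<open>add T\<close>. As projectives
  have injective dimension at most 1, its syzygies split from the left down to the kernel of
  \<open>T0 \<rightarrow> M\<close>, so the kernel of \<open>F K \<rightarrow> F T0\<close> is the image of an idempotent of \<open>K\<close>. Splitting it off
  gives a direct summand of \<open>M\<close> in \<open>add T[1]\<close>, which must vanish because \<open>M\<close> is indecomposable and
  not in \<open>add T[1]\<close>.
\<close>

section \<open>Additive categories\<close>

text \<open>The proof stays inside C: surjectivity, injectivity, exactness and splitting are tested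
  only on arrows out of T, and no quotient category is formed. This suffices because arrows leaving
  an object of add T are determined by their composites with arrows from T. A syzygy, however, is
  only a module until it is known to split, so its splitting is recorded by an endomorphism of an
  object of add T that is the identity on the kernel and is killed by the differential. The bound on
  the injective dimension enters as follows. Let A2 -> A1 -> A0 be exact under F, with the kernel of
  F A2 -> F A1 a direct summand. Then the image P of that map is projective, and the inclusion of P
  in F A1 is governed by a second extension of the cokernel of F A1 -> F A0 by P, which vanishes.
  The given resolution need not be compared with a chosen approximation: its own term in degree 0
  serves as T0, since injectivity of F K -> F T0 forces I_M = 0 for every triangle with T0 in add T.
  Splitting of idempotents enters in two places: to realise projective modules by objects of add T,
  and to turn the idempotent of K into a summand.\<close>

context additive_category
begin

lemma Hom_Ob: "f \<in> Hom C X Y \<Longrightarrow> X \<in> Ob C \<and> Y \<in> Ob C"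
  using Dom_in Cod_in by (auto simp: Hom_def)

lemma Zer_in: "X \<in> Ob C \<Longrightarrow> Y \<in> Ob C \<Longrightarrow> Zer C X Y \<in> Hom C X Y"
  using group.is_monoid[OF comm_group.axioms(2)[OF hom_group[of X Y]]]
  by (auto simp: hom_group_def dest: monoid.one_closed)

lemma Add_in:
  assumes "f \<in> Hom C X Y" "g \<in> Hom C X Y"
  shows "Add C f g \<in> Hom C X Y"
proof -
  interpret comm_group "hom_group C X Y" using assms Hom_Ob hom_group by blast
  show ?thesis using assms m_closed by (simp add: hom_group_def)
qed

lemma Add_assoc:
  assumes "f \<in> Hom C X Y" "g \<in> Hom C X Y" "h \<in> Hom C X Y"
  shows "Add C (Add C f g) h = Add C f (Add C g h)"
proof -
  interpret comm_group "hom_group C X Y" using assms Hom_Ob hom_group by blast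
  show ?thesis using assms m_assoc by (simp add: hom_group_def)
qed

lemma Add_commute:
  assumes "f \<in> Hom C X Y" "g \<in> Hom C X Y"
  shows "Add C f g = Add C g f"
proof -
  interpret comm_group "hom_group C X Y" using assms Hom_Ob hom_group by blast
  show ?thesis using assms m_comm by (simp add: hom_group_def)
qed

lemma Add_Zer:
  assumes "f \<in> Hom C X Y"
  shows "Add C f (Zer C X Y) = f"
proof -
  interpret comm_group "hom_group C X Y" using assms Hom_Ob hom_group by blast
  show ?thesis using assms r_one by (simp add: hom_group_def)
qed

lemma Zer_Add: "f \<in> Hom C X Y \<Longrightarrow> Add C (Zer C X Y) f = f"
  using Add_Zer[of f X Y] Add_commute[of f X Y "Zer C X Y"] Zer_in[of X Y] Hom_Ob[of f X Y] by simp

lemma Neg_in: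
  assumes "f \<in> Hom C X Y"
  shows "Neg C f \<in> Hom C X Y"
proof -
  interpret comm_group "hom_group C X Y" using assms Hom_Ob hom_group by blast
  show ?thesis using assms inv_closed[of f] by (simp add: hom_group_def Neg_def Hom_def)
qed

lemma Add_Neg:
  assumes "f \<in> Hom C X Y"
  shows "Add C f (Neg C f) = Zer C X Y"
proof -
  interpret comm_group "hom_group C X Y" using assms Hom_Ob hom_group by blast
  show ?thesis using assms r_inv[of f] by (simp add: hom_group_def Neg_def Hom_def)
qed

lemma Neg_unique:
  assumes "f \<in> Hom C X Y" "g \<in> Hom C X Y" "Add C f g = Zer C X Y"
  shows "g = Neg C f"
proof -
  interpret comm_group "hom_group C X Y" using assms Hom_Ob hom_group by blast
  show ?thesis using assms inv_equality[of g f] m_comm[of f g]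
    by (simp add: hom_group_def Neg_def Hom_def)
qed

lemma Add_self_eq:
  assumes "f \<in> Hom C X Y" "Add C f f = f"
  shows "f = Zer C X Y"
  using Add_assoc[OF assms(1) assms(1) Neg_in[OF assms(1)]] Add_Neg[OF assms(1)] Add_Zer[OF assms(1)]
  by (simp add: assms(2))

lemma Comp_Zer:
  assumes "g \<in> Hom C Y Z" "X \<in> Ob C"
  shows "g \<cdot> Zer C X Y = Zer C X Z"
proof -
  have 0: "Zer C X Y \<in> Hom C X Y" using assms Zer_in Hom_Ob by blast
  have "g \<cdot> Zer C X Y = Add C (g \<cdot> Zer C X Y) (g \<cdot> Zer C X Y)"
    using Comp_Add[OF 0 0 assms(1)] Add_Zer[OF 0] by simp
  then show ?thesis using Add_self_eq Comp_in[OF 0 assms(1)] by metis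
qed

lemma Zer_Comp:
  assumes "f \<in> Hom C X Y" "Z \<in> Ob C"
  shows "Zer C Y Z \<cdot> f = Zer C X Z"
proof -
  have 0: "Zer C Y Z \<in> Hom C Y Z" using assms Zer_in Hom_Ob by blast
  have "Zer C Y Z \<cdot> f = Add C (Zer C Y Z \<cdot> f) (Zer C Y Z \<cdot> f)"
    using Add_Comp[OF assms(1) 0 0] Add_Zer[OF 0] by simp
  then show ?thesis using Add_self_eq Comp_in[OF assms(1) 0] by metis
qed

lemma Comp_Neg:
  assumes "f \<in> Hom C X Y" "g \<in> Hom C Y Z"
  shows "g \<cdot> Neg C f = Neg C (g \<cdot> f)"
proof (rule Neg_unique)
  show "Add C (g \<cdot> f) (g \<cdot> Neg C f) = Zer C X Z"
    using Comp_Add[OF assms(1) Neg_in[OF assms(1)] assms(2)] Add_Neg[OF assms(1)] assms Comp_Zer Hom_Ob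
    by metis
qed (use assms Comp_in Neg_in in blast)+

lemma Neg_Comp:
  assumes "f \<in> Hom C X Y" "g \<in> Hom C Y Z"
  shows "Neg C g \<cdot> f = Neg C (g \<cdot> f)"
proof (rule Neg_unique)
  show "Add C (g \<cdot> f) (Neg C g \<cdot> f) = Zer C X Z"
    using Add_Comp[OF assms Neg_in[OF assms(2)]] Add_Neg[OF assms(2)] assms Zer_Comp Hom_Ob
    by metis
qed (use assms Comp_in Neg_in in blast)+

lemma Neg_Neg: "f \<in> Hom C X Y \<Longrightarrow> Neg C (Neg C f) = f"
  using Neg_unique[of "Neg C f" X Y f] Neg_in[of f X Y] Add_Neg[of f X Y] Add_commute[of f X Y "Neg C f"]
  by simp

lemma Neg_Zer: "X \<in> Ob C \<Longrightarrow> Y \<in> Ob C \<Longrightarrow> Neg C (Zer C X Y) = Zer C X Y"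
  using Neg_unique[of "Zer C X Y" X Y "Zer C X Y"] Zer_in[of X Y] Add_Zer[of "Zer C X Y" X Y] by simp

lemma Neg_eq_Zer_iff: "f \<in> Hom C X Y \<Longrightarrow> Neg C f = Zer C X Y \<longleftrightarrow> f = Zer C X Y"
  using Neg_Neg[of f X Y] Neg_Zer[of X Y] Hom_Ob[of f X Y] by auto

definition Sub :: "'a \<Rightarrow> 'a \<Rightarrow> 'a" where "Sub f g = Add C f (Neg C g)"

lemma Sub_in: "f \<in> Hom C X Y \<Longrightarrow> g \<in> Hom C X Y \<Longrightarrow> Sub f g \<in> Hom C X Y"
  by (simp add: Sub_def Add_in Neg_in)

lemma Comp_Sub:
  "f \<in> Hom C X Y \<Longrightarrow> f' \<in> Hom C X Y \<Longrightarrow> g \<in> Hom C Y Z \<Longrightarrow> g \<cdot> Sub f f' = Sub (g \<cdot> f) (g \<cdot> f')"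
  by (simp add: Sub_def Comp_Add[OF _ Neg_in] Comp_Neg)

lemma Sub_Comp:
  "f \<in> Hom C X Y \<Longrightarrow> g \<in> Hom C Y Z \<Longrightarrow> g' \<in> Hom C Y Z \<Longrightarrow> Sub g g' \<cdot> f = Sub (g \<cdot> f) (g' \<cdot> f)"
  by (simp add: Sub_def Add_Comp[OF _ _ Neg_in] Neg_Comp)

lemma Sub_self: "f \<in> Hom C X Y \<Longrightarrow> Sub f f = Zer C X Y"
  by (simp add: Sub_def Add_Neg)

lemma Sub_Zer: "f \<in> Hom C X Y \<Longrightarrow> Sub f (Zer C X Y) = f"
  using Hom_Ob by (simp add: Sub_def Neg_Zer Add_Zer)

lemma Add_Sub: "f \<in> Hom C X Y \<Longrightarrow> g \<in> Hom C X Y \<Longrightarrow> Add C g (Sub f g) = f"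
  using Add_commute[of g X Y "Sub f g"] Sub_in[of f X Y g] Add_assoc[of f X Y "Neg C g" g] Neg_in[of g X Y]
    Add_commute[of g X Y "Neg C g"] Add_Neg[of g X Y] Add_Zer[of f X Y]
  by (simp add: Sub_def)

lemma Sub_eq_Zer_iff:
  "f \<in> Hom C X Y \<Longrightarrow> g \<in> Hom C X Y \<Longrightarrow> Sub f g = Zer C X Y \<longleftrightarrow> f = g"
  using Add_Sub[of f X Y g] Add_Zer[of g X Y] Sub_self[of g X Y] by auto

lemma zero_object_Dom: "zero_object C Z \<Longrightarrow> f \<in> Hom C Z X \<Longrightarrow> f = Zer C Z X"
  using Comp_Id[of f Z X] Comp_Zer[of f Z X Z] by (simp add: zero_object_def)

lemma zero_object_Cod: "zero_object C Z \<Longrightarrow> f \<in> Hom C X Z \<Longrightarrow> f = Zer C X Z"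
  using Id_Comp[of f X Z] Zer_Comp[of f X Z Z] by (simp add: zero_object_def)

text \<open>Names the four structure maps that \<open>direct_sum\<close> hides behind quantifiers,
  so that they can be composed and shifted.\<close>

definition biproduct :: "'o \<Rightarrow> 'o \<Rightarrow> 'o \<Rightarrow> 'a \<Rightarrow> 'a \<Rightarrow> 'a \<Rightarrow> 'a \<Rightarrow> bool"
  where "biproduct Z X Y i1 i2 p1 p2 \<longleftrightarrow>
    i1 \<in> Hom C X Z \<and> i2 \<in> Hom C Y Z \<and> p1 \<in> Hom C Z X \<and> p2 \<in> Hom C Z Y \<and>
    p1 \<cdot> i1 = Id C X \<and> p2 \<cdot> i2 = Id C Y \<and> p1 \<cdot> i2 = Zer C Y X \<and> p2 \<cdot> i1 = Zer C X Y \<and>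
    Add C (i1 \<cdot> p1) (i2 \<cdot> p2) = Id C Z"

lemma direct_sum_iff: "direct_sum C Z X Y \<longleftrightarrow> (\<exists>i1 i2 p1 p2. biproduct Z X Y i1 i2 p1 p2)"
  unfolding direct_sum_def biproduct_def using Hom_Ob by blast

lemma biproduct_commute:
  assumes "biproduct Z X Y i1 i2 p1 p2"
  shows "biproduct Z Y X i2 i1 p2 p1"
proof -
  have "i1 \<cdot> p1 \<in> Hom C Z Z" "i2 \<cdot> p2 \<in> Hom C Z Z"
    using assms Comp_in unfolding biproduct_def by blast+
  then show ?thesis using assms Add_commute unfolding biproduct_def by metis
qed

lemma direct_sum_commute: "direct_sum C Z X Y \<Longrightarrow> direct_sum C Z Y X"
  using biproduct_commute unfolding direct_sum_iff by blast

lemma biproduct_decompose: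
  assumes "biproduct Z X Y i1 i2 p1 p2"
  shows "f \<in> Hom C W Z \<Longrightarrow> Add C (i1 \<cdot> (p1 \<cdot> f)) (i2 \<cdot> (p2 \<cdot> f)) = f"
    and "g \<in> Hom C Z W \<Longrightarrow> Add C ((g \<cdot> i1) \<cdot> p1) ((g \<cdot> i2) \<cdot> p2) = g"
proof -
  have h: "i1 \<in> Hom C X Z" "i2 \<in> Hom C Y Z" "p1 \<in> Hom C Z X" "p2 \<in> Hom C Z Y"
    and s: "Add C (i1 \<cdot> p1) (i2 \<cdot> p2) = Id C Z"
    using assms unfolding biproduct_def by blast+
  note e = Comp_in[OF h(3,1)] Comp_in[OF h(4,2)]
  show "Add C (i1 \<cdot> (p1 \<cdot> f)) (i2 \<cdot> (p2 \<cdot> f)) = f" if "f \<in> Hom C W Z"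
    using Add_Comp[OF that e] Comp_assoc[OF that h(3,1)] Comp_assoc[OF that h(4,2)] s Id_Comp[OF that]
    by simp
  show "Add C ((g \<cdot> i1) \<cdot> p1) ((g \<cdot> i2) \<cdot> p2) = g" if "g \<in> Hom C Z W"
    using Comp_Add[OF e that] Comp_assoc[OF h(3,1) that] Comp_assoc[OF h(4,2) that] s Comp_Id[OF that]
    by simp
qed

section \<open>Summands of finite sums of copies of \<open>T\<close>\<close>

lemma copies_Ob: "copies C T n Z \<Longrightarrow> Z \<in> Ob C"
  by (cases n) (auto simp: zero_object_def direct_sum_def)

lemma ex_copies: "T \<in> Ob C \<Longrightarrow> \<exists>Z. copies C T n Z"
proof (induction n)
  case 0 then show ?case using ex_zero_object by simp
next
  case (Suc n) then show ?case using ex_direct_sum copies_Ob by simp blast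
qed

lemma add_objE:
  assumes "X \<in> add_obj C T"
  obtains n Z i p where "copies C T n Z" "i \<in> Hom C X Z" "p \<in> Hom C Z X" "p \<cdot> i = Id C X"
  using assms unfolding add_obj_def direct_sum_def by blast

lemma add_obj_Ob: "X \<in> add_obj C T \<Longrightarrow> X \<in> Ob C"
  unfolding add_obj_def direct_sum_def by blast

text \<open>Builds a finite sum one copy of \<open>T\<close> at a time and then passes to a summand.
  The complement of the summand is forgotten: a split pair \<open>i\<close>, \<open>p\<close> is all
  that later inductions use.\<close>

lemma add_obj_induct [consumes 1, case_names zero sum retract]:
  assumes "X \<in> add_obj C T"
    and zero: "\<And>Z. zero_object C Z \<Longrightarrow> P Z"
    and sum: "\<And>Z W i1 i2 p1 p2. P W \<Longrightarrow> biproduct Z W T i1 i2 p1 p2 \<Longrightarrow> P Z"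
    and retract: "\<And>X Z i p. P Z \<Longrightarrow> i \<in> Hom C X Z \<Longrightarrow> p \<in> Hom C Z X \<Longrightarrow> p \<cdot> i = Id C X \<Longrightarrow> P X"
  shows "P X"
proof -
  obtain n Z i p where Z: "copies C T n Z" "i \<in> Hom C X Z" "p \<in> Hom C Z X" "p \<cdot> i = Id C X"
    using assms(1) by (rule add_objE)
  have "P Z" if "copies C T n Z" for n Z
    using that
  proof (induction n arbitrary: Z)
    case 0 then show ?case using zero by simp
  next
    case (Suc n) then show ?case using sum unfolding copies.simps direct_sum_iff by blast
  qed
  with Z retract show ?thesis by blast
qed

lemma copies_in_add_obj:
  assumes "T \<in> Ob C" "copies C T n Z"
  shows "Z \<in> add_obj C T"
proof -
  obtain Z0 where Z0: "zero_object C Z0" using ex_zero_object by blast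
  then have o: "Z0 \<in> Ob C" "Z \<in> Ob C" using copies_Ob[OF assms(2)] unfolding zero_object_def by auto
  have "biproduct Z Z Z0 (Id C Z) (Zer C Z0 Z) (Id C Z) (Zer C Z Z0)"
    unfolding biproduct_def
    using Z0 o Id_in[of Z] Zer_in[of Z Z0] Zer_in[of Z0 Z] Id_Comp[of "Id C Z"] Id_Comp[of "Zer C Z0 Z"]
      Comp_Id[of "Zer C Z Z0"] Add_Zer[of "Id C Z" Z Z] Zer_Comp[of "Zer C Z Z0" Z Z0 Z]
      Zer_Comp[of "Zer C Z0 Z" Z0 Z Z0]
    by (auto simp: zero_object_def)
  then show ?thesis using assms(2) unfolding add_obj_def direct_sum_iff by blast
qed

text \<open>This is projectivity relative to \<open>T\<close>: lifts chosen on the separate copies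
  of \<open>T\<close> add up to a lift on the sum, and restrict to a retract. The lifts of the
  various \<open>t\<close> need not be compatible, as each copy uses only the one for its own
  inclusion.\<close>

lemma add_obj_factor:
  assumes "X \<in> add_obj C T" "h \<in> Hom C A B"
    and "f \<in> Hom C X B" "\<And>t. t \<in> Hom C T X \<Longrightarrow> \<exists>s \<in> Hom C T A. f \<cdot> t = h \<cdot> s"
  shows "\<exists>s \<in> Hom C X A. f = h \<cdot> s"
  using assms(1,3,4)
proof (induction arbitrary: f rule: add_obj_induct)
  case (zero Z)
  then show ?case
    using zero_object_Dom[OF zero(1,2)] Comp_Zer[OF assms(2), of Z] Zer_in[of Z A] Hom_Ob[OF assms(2)]
    unfolding zero_object_def by metis
next
  case (sum Z W i1 i2 p1 p2)
  have h: "i1 \<in> Hom C W Z" "i2 \<in> Hom C T Z" "p1 \<in> Hom C Z W" "p2 \<in> Hom C Z T"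
    using sum(2) unfolding biproduct_def by blast+
  have "\<exists>s \<in> Hom C W A. f \<cdot> i1 = h \<cdot> s"
  proof (rule sum(1)[OF Comp_in[OF h(1) sum(3)]])
    fix t assume t: "t \<in> Hom C T W"
    show "\<exists>s \<in> Hom C T A. (f \<cdot> i1) \<cdot> t = h \<cdot> s"
      using sum(4)[OF Comp_in[OF t h(1)]] Comp_assoc[OF t h(1) sum(3)] by simp
  qed
  then obtain s1 where s1: "s1 \<in> Hom C W A" "f \<cdot> i1 = h \<cdot> s1" by blast
  obtain s2 where s2: "s2 \<in> Hom C T A" "f \<cdot> i2 = h \<cdot> s2" using sum(4)[OF h(2)] by blast
  have "f = h \<cdot> Add C (s1 \<cdot> p1) (s2 \<cdot> p2)"
    using biproduct_decompose(2)[OF sum(2,3)] s1(2) s2(2)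
      Comp_Add[OF Comp_in[OF h(3) s1(1)] Comp_in[OF h(4) s2(1)] assms(2)]
      Comp_assoc[OF h(3) s1(1) assms(2)] Comp_assoc[OF h(4) s2(1) assms(2)] by simp
  moreover have "Add C (s1 \<cdot> p1) (s2 \<cdot> p2) \<in> Hom C Z A"
    using Add_in Comp_in h s1 s2 by metis
  ultimately show ?case by blast
next
  case (retract X Z i p)
  have "\<exists>s \<in> Hom C Z A. f \<cdot> p = h \<cdot> s"
  proof (rule retract(1)[OF Comp_in[OF retract(3,5)]])
    fix t assume t: "t \<in> Hom C T Z"
    show "\<exists>s \<in> Hom C T A. (f \<cdot> p) \<cdot> t = h \<cdot> s"
      using retract(6)[OF Comp_in[OF t retract(3)]] Comp_assoc[OF t retract(3,5)] by simp
  qed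
  then obtain s where s: "s \<in> Hom C Z A" "f \<cdot> p = h \<cdot> s" by blast
  have "f = h \<cdot> (s \<cdot> i)"
    using Comp_assoc[OF retract(2,3,5)] Comp_Id[OF retract(5)] Comp_assoc[OF retract(2) s(1) assms(2)]
      retract(4) s(2) by simp
  with s(1) retract(2) Comp_in show ?case by blast
qed

text \<open>The difference of the two arrows factors through a zero object on every arrow from
  \<open>T\<close>, hence altogether by \<open>add_obj_factor\<close>.\<close>

lemma add_obj_faithful:
  assumes "X \<in> add_obj C T" "f \<in> Hom C X Y" "g \<in> Hom C X Y"
    and "\<And>t. t \<in> Hom C T X \<Longrightarrow> f \<cdot> t = g \<cdot> t"
  shows "f = g"
proof -
  obtain Z where Z: "zero_object C Z" using ex_zero_object by blast
  have o: "Z \<in> Ob C" "Y \<in> Ob C" using Z Hom_Ob[OF assms(2)] unfolding zero_object_def by blast+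
  have z: "Zer C Z Y \<in> Hom C Z Y" using o Zer_in by blast
  have "\<exists>s \<in> Hom C X Z. Sub f g = Zer C Z Y \<cdot> s"
  proof (rule add_obj_factor[OF assms(1) z Sub_in[OF assms(2,3)]])
    fix t assume t: "t \<in> Hom C T X"
    have "Sub f g \<cdot> t = Zer C T Y"
      using Sub_Comp[OF t assms(2,3)] assms(4)[OF t] Sub_self[OF Comp_in[OF t assms(3)]] by simp
    moreover have "Zer C T Y = Zer C Z Y \<cdot> Zer C T Z" using Comp_Zer[OF z] t Hom_Ob by simp
    ultimately show "\<exists>s \<in> Hom C T Z. Sub f g \<cdot> t = Zer C Z Y \<cdot> s"
      using Zer_in[of T Z] t Hom_Ob o by metis
  qed
  then have "Sub f g = Zer C X Y" using Zer_Comp o by metis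
  then show ?thesis using Sub_eq_Zer_iff assms(2,3) by blast
qed

end

section \<open>Triangulated categories\<close>

context triangulated_category
begin

lemma ShA_in: "f \<in> Hom C X Y \<Longrightarrow> ShA C f \<in> Hom C (ShO C X) (ShO C Y)"
  using bij_betw_apply[OF ShA_bij[of X Y]] Hom_Ob[of f X Y] by simp

lemma ShA_inj: "f \<in> Hom C X Y \<Longrightarrow> g \<in> Hom C X Y \<Longrightarrow> ShA C f = ShA C g \<Longrightarrow> f = g"
  using inj_onD[OF bij_betw_imp_inj_on[OF ShA_bij[of X Y]], of f g] Hom_Ob[of f X Y] by simp

lemma ShA_surj:
  assumes "X \<in> Ob C" "Y \<in> Ob C" "g \<in> Hom C (ShO C X) (ShO C Y)"
  obtains f where "f \<in> Hom C X Y" "g = ShA C f"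
  using bij_betw_imp_surj_on[OF ShA_bij[OF assms(1,2)]] assms(3) that by (auto simp: image_iff set_eq_iff)

lemma ShA_Zer: "X \<in> Ob C \<Longrightarrow> Y \<in> Ob C \<Longrightarrow> ShA C (Zer C X Y) = Zer C (ShO C X) (ShO C Y)"
  using Add_self_eq[OF ShA_in[OF Zer_in]] ShA_Add[of "Zer C X Y" X Y "Zer C X Y"] Zer_in[of X Y]
    Add_Zer[of "Zer C X Y" X Y] by simp

lemma ShA_eq_Zer_iff: "f \<in> Hom C X Y \<Longrightarrow> ShA C f = Zer C (ShO C X) (ShO C Y) \<longleftrightarrow> f = Zer C X Y"
  using ShA_inj[of f X Y "Zer C X Y"] ShA_Zer[of X Y] Zer_in[of X Y] Hom_Ob[of f X Y] by auto

lemma ShA_Neg: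
  assumes "f \<in> Hom C X Y"
  shows "ShA C (Neg C f) = Neg C (ShA C f)"
  using ShA_Add[OF assms Neg_in[OF assms]] Add_Neg[OF assms] ShA_Zer[of X Y] Hom_Ob[OF assms]
    Neg_unique[OF ShA_in[OF assms] ShA_in[OF Neg_in[OF assms]]] by simp

lemma zero_object_ShO: "zero_object C Z \<Longrightarrow> zero_object C (ShO C Z)"
  using ShA_Id[of Z] ShA_Zer[of Z Z] ShO_in[of Z] by (simp add: zero_object_def)

lemma biproduct_ShA:
  assumes "biproduct Z X Y i1 i2 p1 p2"
  shows "biproduct (ShO C Z) (ShO C X) (ShO C Y) (ShA C i1) (ShA C i2) (ShA C p1) (ShA C p2)"
proof -
  have h: "i1 \<in> Hom C X Z" "i2 \<in> Hom C Y Z" "p1 \<in> Hom C Z X" "p2 \<in> Hom C Z Y"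
    and e: "p1 \<cdot> i1 = Id C X" "p2 \<cdot> i2 = Id C Y" "p1 \<cdot> i2 = Zer C Y X" "p2 \<cdot> i1 = Zer C X Y"
      "Add C (i1 \<cdot> p1) (i2 \<cdot> p2) = Id C Z"
    using assms unfolding biproduct_def by blast+
  have o: "X \<in> Ob C" "Y \<in> Ob C" "Z \<in> Ob C" using h Hom_Ob by blast+
  show ?thesis
    unfolding biproduct_def
    using h[THEN ShA_in] e ShA_Comp[OF h(1,3)] ShA_Comp[OF h(2,4)] ShA_Comp[OF h(2,3)]
      ShA_Comp[OF h(1,4)] ShA_Comp[OF h(3,1)] ShA_Comp[OF h(4,2)] ShA_Zer o ShA_Id
      ShA_Add[OF Comp_in[OF h(3,1)] Comp_in[OF h(4,2)]]
    by auto
qed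

lemma iso_arrow_Id: "X \<in> Ob C \<Longrightarrow> iso_arrow C X X (Id C X)"
  using Id_in[of X] Comp_Id[of "Id C X" X X] unfolding iso_arrow_def by auto

section \<open>Exactness properties of distinguished triangles\<close>

lemma dist_triangle_Hom:
  assumes "dist_triangle C X Y Z u v w"
  shows "u \<in> Hom C X Y" "v \<in> Hom C Y Z" "w \<in> Hom C Z (ShO C X)"
  using assms unfolding dist_triangle_def triangle_def by blast+

lemma dist_triangle_rotate:
  "dist_triangle C X Y Z u v w \<Longrightarrow> dist_triangle C Y Z (ShO C X) v w (Neg C (ShA C u))"
  using TR2[of X Y Z u v w] by (simp add: dist_triangle_def)

lemma dist_triangle_zero_Id:
  assumes "zero_object C Z" "W \<in> Ob C"
  shows "dist_triangle C Z W W (Zer C Z W) (Id C W) (Zer C W (ShO C Z))"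
proof -
  have o: "Z \<in> Ob C" "ShO C Z \<in> Ob C" "ShO C W \<in> Ob C"
    using assms ShO_in unfolding zero_object_def by blast+
  have "triangle C Z W W (Zer C Z W) (Id C W) (Zer C W (ShO C Z))"
    unfolding triangle_def using o assms Zer_in Id_in by blast
  then show ?thesis
    using TR2 TR1_Id[OF assms(2) zero_object_ShO[OF assms(1)]] ShA_Zer[OF o(1) assms(2)]
      Neg_Zer[OF o(2,3)] by simp
qed

text \<open>Map the triangle on the identity of \<open>X\<close> to the given one by the identity
  and \<open>u\<close>; the third component starts at a zero object.\<close>

lemma dist_triangle_comp:
  assumes "dist_triangle C X Y Z u v w"
  shows "v \<cdot> u = Zer C X Z"
proof -
  note h = dist_triangle_Hom[OF assms]
  have o: "X \<in> Ob C" using h(1) Hom_Ob by blast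
  obtain N where N: "zero_object C N" using ex_zero_object by blast
  obtain c where c: "c \<in> Hom C N Z" "c \<cdot> Zer C X N = v \<cdot> u"
    using TR3[OF TR1_Id[OF o N] assms Id_in[OF o] h(1)] by blast
  then show ?thesis using Comp_Zer[OF c(1) o] by simp
qed

lemma dist_triangle_comp_rotate:
  assumes "dist_triangle C X Y Z u v w"
  shows "w \<cdot> v = Zer C Y (ShO C X)" "ShA C u \<cdot> w = Zer C Z (ShO C Y)"
proof -
  note h = dist_triangle_Hom[OF assms]
  note r = dist_triangle_rotate[OF assms]
  show "w \<cdot> v = Zer C Y (ShO C X)" using dist_triangle_comp[OF r] .
  show "ShA C u \<cdot> w = Zer C Z (ShO C Y)"
    using dist_triangle_comp[OF dist_triangle_rotate[OF r]] Neg_Comp[OF h(3) ShA_in[OF h(1)]]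
      Neg_eq_Zer_iff[OF Comp_in[OF h(3) ShA_in[OF h(1)]]] by simp
qed

text \<open>\<open>TR3\<close> completes the last arrow of a morphism of triangles, so both the
  triangle on the identity of \<open>W\<close> and the given one are rotated first. The completed
  arrow lives between shifts and is brought back by fullness; the signs of the two rotations
  cancel.\<close>

lemma dist_triangle_lift:
  assumes "dist_triangle C X Y Z u v w" "f \<in> Hom C W Y" "v \<cdot> f = Zer C W Z"
  obtains g where "g \<in> Hom C W X" "f = u \<cdot> g"
proof -
  note h = dist_triangle_Hom[OF assms(1)]
  have o: "W \<in> Ob C" "X \<in> Ob C" "Z \<in> Ob C" using h assms(2) Hom_Ob by blast+
  obtain N where N: "zero_object C N" using ex_zero_object by blast
  then have oN: "N \<in> Ob C" by (simp add: zero_object_def)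
  note tW = dist_triangle_rotate[OF TR1_Id[OF o(1) N]]
  have "Zer C N Z \<cdot> Zer C W N = v \<cdot> f"
    using assms(3) Zer_Comp[OF Zer_in[OF o(1) oN] o(3)] by simp
  then obtain c where c: "c \<in> Hom C (ShO C W) (ShO C X)"
      "ShA C f \<cdot> Neg C (ShA C (Id C W)) = Neg C (ShA C u) \<cdot> c"
    using TR3[OF tW dist_triangle_rotate[OF assms(1)] assms(2) Zer_in[OF oN o(3)]] by blast
  obtain g where g: "g \<in> Hom C W X" "c = ShA C g" using ShA_surj[OF o(1,2) c(1)] .
  have "Neg C (ShA C f) = Neg C (ShA C (u \<cdot> g))"
    using c(2) g ShA_Id[OF o(1)] Comp_Neg[OF Id_in[OF ShO_in[OF o(1)]] ShA_in[OF assms(2)]]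
      Comp_Id[OF ShA_in[OF assms(2)]] Neg_Comp[OF ShA_in[OF g(1)] ShA_in[OF h(1)]]
      ShA_Comp[OF g(1) h(1)] by simp
  then have "ShA C f = ShA C (u \<cdot> g)"
    using Neg_Neg[OF ShA_in[OF assms(2)]] Neg_Neg[OF ShA_in[OF Comp_in[OF g(1) h(1)]]]
    by metis
  then show ?thesis using that g(1) ShA_inj[OF assms(2) Comp_in[OF g(1) h(1)]] by blast
qed

text \<open>The target of the comparison is the triangle on a zero object and the identity of
  \<open>W\<close>.\<close>

lemma dist_triangle_extend:
  assumes "dist_triangle C X Y Z u v w" "f \<in> Hom C Y W" "f \<cdot> u = Zer C X W"
  obtains g where "g \<in> Hom C Z W" "f = g \<cdot> v"
proof -
  note h = dist_triangle_Hom[OF assms(1)]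
  have o: "W \<in> Ob C" "X \<in> Ob C" using h assms(2) Hom_Ob by blast+
  obtain N where N: "zero_object C N" using ex_zero_object by blast
  then have oN: "N \<in> Ob C" by (simp add: zero_object_def)
  have "f \<cdot> u = Zer C N W \<cdot> Zer C X N"
    using assms(3) Zer_Comp[OF Zer_in[OF o(2) oN] o(1)] by simp
  then obtain c where c: "c \<in> Hom C Z W" "c \<cdot> v = Id C W \<cdot> f"
    using TR3[OF assms(1) dist_triangle_zero_Id[OF N o(1)] Zer_in[OF o(2) oN] assms(2)] by blast
  then show ?thesis using that Id_Comp[OF assms(2)] by simp
qed

lemma dist_triangle_lift_shift:
  assumes "dist_triangle C X Y Z u v w" "f \<in> Hom C W (ShO C X)" "ShA C u \<cdot> f = Zer C W (ShO C Y)"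
  obtains g where "g \<in> Hom C W Z" "f = w \<cdot> g"
proof -
  note h = dist_triangle_Hom[OF assms(1)]
  have "Neg C (ShA C u) \<cdot> f = Zer C W (ShO C Y)"
    using assms(3) Neg_Comp[OF assms(2) ShA_in[OF h(1)]]
      Neg_Zer[of W "ShO C Y"] Hom_Ob[OF assms(2)] Hom_Ob[OF ShA_in[OF h(1)]] by simp
  then show ?thesis
    using dist_triangle_lift[OF dist_triangle_rotate[OF dist_triangle_rotate[OF assms(1)]] assms(2)]
      that by blast
qed

lemma dist_triangle_extend_shift:
  assumes "dist_triangle C X Y Z u v w" "f \<in> Hom C X W" "ShA C f \<cdot> w = Zer C Z (ShO C W)"
  obtains g where "g \<in> Hom C Y W" "f = g \<cdot> u"
proof -
  note h = dist_triangle_Hom[OF assms(1)]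
  have o: "Y \<in> Ob C" "W \<in> Ob C" using h assms(2) Hom_Ob by blast+
  obtain g where g: "g \<in> Hom C (ShO C Y) (ShO C W)" "ShA C f = g \<cdot> Neg C (ShA C u)"
    using dist_triangle_extend[OF dist_triangle_rotate[OF dist_triangle_rotate[OF assms(1)]]
      ShA_in[OF assms(2)] assms(3)] .
  obtain g' where g': "g' \<in> Hom C Y W" "g = ShA C g'" using ShA_surj[OF o g(1)] .
  \<comment> \<open>The sign of the rotation is absorbed into the extension, which is
    \<open>Neg C g'\<close> and not \<open>g'\<close>.\<close>
  have "ShA C f = ShA C (Neg C g' \<cdot> u)"
    using g g' Comp_Neg[OF ShA_in[OF h(1)] g(1)] ShA_Comp[OF h(1) g'(1)] Neg_Comp[OF h(1) g'(1)]
      ShA_Neg[OF Comp_in[OF h(1) g'(1)]] by simp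
  then show ?thesis
    using that[OF Neg_in[OF g'(1)]] ShA_inj[OF assms(2) Comp_in[OF h(1) Neg_in[OF g'(1)]]] by blast
qed

text \<open>\<open>TR1_cone\<close> places the arrow first, but a cocone is wanted. Since the shift
  is only dense, the cone is first replaced by an isomorphic object of the form
  \<open>ShO C K\<close>.\<close>

lemma ex_dist_triangle_middle:
  assumes "a \<in> Hom C Y Z"
  obtains X u w where "dist_triangle C X Y Z u a w"
proof -
  have o: "Y \<in> Ob C" "Z \<in> Ob C" using assms Hom_Ob by blast+
  obtain L b c where L: "dist_triangle C Y Z L a b c" using TR1_cone[OF o assms] by blast
  note h = dist_triangle_Hom[OF L]
  have oL: "L \<in> Ob C" using h Hom_Ob by blast
  obtain K s t where K: "K \<in> Ob C" and s: "s \<in> Hom C (ShO C K) L"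
    and t: "t \<in> Hom C L (ShO C K)" "t \<cdot> s = Id C (ShO C K)" "s \<cdot> t = Id C L"
    using ShO_dense[OF oL] unfolding iso_arrow_def by blast
  have it: "iso_arrow C L (ShO C K) t" using s t unfolding iso_arrow_def by blast
  note tb = Comp_in[OF h(2) t(1)] and cs = Comp_in[OF s h(3)]
  have tr: "triangle C Y Z (ShO C K) a (t \<cdot> b) (c \<cdot> s)"
    unfolding triangle_def using o K ShO_in assms tb cs by blast
  have "dist_triangle C Y Z (ShO C K) a (t \<cdot> b) (c \<cdot> s)"
  proof (rule TR1_iso[OF L tr iso_arrow_Id[OF o(1)] iso_arrow_Id[OF o(2)] it])
    show "Id C Z \<cdot> a = a \<cdot> Id C Y" using Id_Comp[OF assms] Comp_Id[OF assms] by simp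
    show "t \<cdot> b = (t \<cdot> b) \<cdot> Id C Z" using Comp_Id[OF tb] by simp
    show "ShA C (Id C Y) \<cdot> c = (c \<cdot> s) \<cdot> t"
      using ShA_Id[OF o(1)] Id_Comp[OF h(3)] Comp_assoc[OF t(1) s h(3)] t(3) Comp_Id[OF h(3)] by simp
  qed
  \<comment> \<open>The sign is chosen so that rotating the triangle on \<open>u\<close> and
    \<open>a\<close> gives back \<open>c \<cdot> s\<close> as its third arrow; \<open>TR2\<close> is
    then read backwards.\<close>
  moreover obtain u where u: "u \<in> Hom C K Y" "Neg C (c \<cdot> s) = ShA C u"
    using ShA_surj[OF K o(1) Neg_in[OF cs]] .
  moreover have "c \<cdot> s = Neg C (ShA C u)" using u(2) Neg_Neg[OF cs] by simp
  moreover have "triangle C K Y Z u a (t \<cdot> b)"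
    unfolding triangle_def using o K u(1) assms tb by blast
  ultimately have "dist_triangle C K Y Z u a (t \<cdot> b)" using TR2 by simp
  then show ?thesis using that by blast
qed

text \<open>The cone of \<open>s\<close> is the complement. Its connecting arrow \<open>w\<close> is
  killed by \<open>ShA C s\<close>, which has a left inverse, so \<open>w\<close> is zero and
  \<open>q\<close> has a section.\<close>

lemma split_mono_direct_sum:
  assumes s: "s \<in> Hom C X M" and r: "r \<in> Hom C M X" and rs: "r \<cdot> s = Id C X"
  obtains W where "direct_sum C M X W"
proof -
  have o: "X \<in> Ob C" "M \<in> Ob C" using s Hom_Ob by blast+
  obtain W q w where tri: "dist_triangle C X M W s q w" using TR1_cone[OF o s] by blast
  note h = dist_triangle_Hom[OF tri]
  have oW: "W \<in> Ob C" using h Hom_Ob by blast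
  have "w = ShA C (r \<cdot> s) \<cdot> w" using rs ShA_Id[OF o(1)] Id_Comp[OF h(3)] by simp
  then have "w = Zer C W (ShO C X)"
    using ShA_Comp[OF s r] Comp_assoc[OF h(3) ShA_in[OF s] ShA_in[OF r]]
      dist_triangle_comp_rotate(2)[OF tri] Comp_Zer[OF ShA_in[OF r] oW] by simp
  then have "w \<cdot> Id C W = Zer C W (ShO C X)" using Comp_Id[OF h(3)] by simp
  then obtain j0 where j0: "j0 \<in> Hom C W M" "Id C W = q \<cdot> j0"
    using dist_triangle_lift[OF dist_triangle_rotate[OF tri] Id_in[OF oW]] by blast
  \<comment> \<open>\<open>j0\<close> is an arbitrary section of \<open>q\<close>. Removing its
    component along \<open>s\<close> makes \<open>r\<close> vanish on it and keeps it a section, as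
    \<open>q\<close> kills \<open>s\<close>.\<close>
  define j where "j = Sub j0 (s \<cdot> (r \<cdot> j0))"
  note rj0 = Comp_in[OF j0(1) r]
  note srj0 = Comp_in[OF rj0 s]
  have j: "j \<in> Hom C W M" unfolding j_def using Sub_in[OF j0(1) srj0] .
  have qs: "q \<cdot> s = Zer C X W" using dist_triangle_comp[OF tri] .
  have qj: "q \<cdot> j = Id C W"
    unfolding j_def using Comp_Sub[OF j0(1) srj0 h(2)] Comp_assoc[OF rj0 s h(2)] qs
      Zer_Comp[OF rj0 oW] j0(2) Sub_Zer[OF Id_in[OF oW]] by simp
  have rj: "r \<cdot> j = Zer C W X"
    unfolding j_def using Comp_Sub[OF j0(1) srj0 r] Comp_assoc[OF rj0 s r] rs
      Id_Comp[OF rj0] Sub_self[OF rj0] by simp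
  \<comment> \<open>The remaining biproduct identity says that \<open>E\<close> equals
    \<open>s \<cdot> r\<close>: since \<open>q\<close> kills \<open>E\<close>, it factors through
    \<open>s\<close>, and composing with \<open>r\<close> identifies the factor.\<close>
  define E where "E = Sub (Id C M) (j \<cdot> q)"
  note jq = Comp_in[OF h(2) j] and i = Id_in[OF o(2)]
  have E: "E \<in> Hom C M M" unfolding E_def using Sub_in[OF i jq] .
  have "q \<cdot> E = Zer C M W"
    unfolding E_def using Comp_Sub[OF i jq h(2)] Comp_assoc[OF h(2) j h(2)] qj
      Id_Comp[OF h(2)] Comp_Id[OF h(2)] Sub_self[OF h(2)] by simp
  then obtain k where k: "k \<in> Hom C M X" "E = s \<cdot> k" using dist_triangle_lift[OF tri E] by blast
  have "r \<cdot> E = r"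
    unfolding E_def using Comp_Sub[OF i jq r] Comp_assoc[OF h(2) j r] rj Comp_Id[OF r]
      Zer_Comp[OF h(2) o(1)] Sub_Zer[OF r] by simp
  then have "k = r" using k Comp_assoc[OF k(1) s r] rs Id_Comp[OF k(1)] by simp
  then have "Add C (s \<cdot> r) (j \<cdot> q) = Id C M"
    using k(2) Add_Sub[OF i jq] Add_commute[OF jq E] by (simp add: E_def)
  then have "biproduct M X W s j r q"
    unfolding biproduct_def using s j r h(2) rs qj rj qs by blast
  then show ?thesis using that direct_sum_iff by blast
qed

lemma copies_ShO: "copies C T n Z \<Longrightarrow> copies C (ShO C T) n (ShO C Z)"
proof (induction n arbitrary: Z)
  case 0 then show ?case using zero_object_ShO by simp
next
  case (Suc n) then show ?case using biproduct_ShA unfolding copies.simps direct_sum_iff by blast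
qed

text \<open>Membership in \<open>add_obj\<close> asks for a complement and not only for a
  retraction; after enlarging \<open>X\<close> to a sum of copies of \<open>T\<close>, the
  complement comes from \<open>split_mono_direct_sum\<close>.\<close>

lemma retract_ShO_in_add_obj:
  assumes X: "X \<in> add_obj C T"
    and s: "s \<in> Hom C M (ShO C X)" and r: "r \<in> Hom C (ShO C X) M" and rs: "r \<cdot> s = Id C M"
  shows "M \<in> add_obj C (ShO C T)"
proof -
  obtain n Z i p where Z: "copies C T n Z" and i: "i \<in> Hom C X Z" and p: "p \<in> Hom C Z X"
    and pi: "p \<cdot> i = Id C X"
    using X by (rule add_objE)
  note i' = ShA_in[OF i] and p' = ShA_in[OF p]
  have "ShA C p \<cdot> ShA C i = Id C (ShO C X)"
    using ShA_Comp[OF i p] pi ShA_Id Hom_Ob[OF i] by simp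
  then have "(r \<cdot> ShA C p) \<cdot> (ShA C i \<cdot> s) = Id C M"
    using Comp_assoc[OF Comp_in[OF s i'] p' r] Comp_assoc[OF s i' p'] rs Id_Comp[OF s] by simp
  then obtain W where "direct_sum C (ShO C Z) M W"
    using split_mono_direct_sum[OF Comp_in[OF s i'] Comp_in[OF p' r]] by blast
  then show ?thesis using copies_ShO[OF Z] unfolding add_obj_def by blast
qed

end

section \<open>Maximal 1-orthogonal objects\<close>

locale maximal_orthogonal = triangulated_category C
  for C :: "('o, 'a, 'm) tri_cat_scheme" (structure) +
  fixes T :: 'o
  assumes max_orth: "maximal_1_orthogonal C T"
begin

lemma T_Ob: "T \<in> Ob C"
  using max_orth unfolding maximal_1_orthogonal_def by blast

lemma T_in_add: "T \<in> add_obj C T"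
proof -
  obtain Z0 where Z0: "zero_object C Z0" using ex_zero_object by blast
  then obtain Z where "direct_sum C Z Z0 T"
    using ex_direct_sum[OF _ T_Ob] unfolding zero_object_def by blast
  then have "copies C T (Suc 0) Z" "direct_sum C Z T Z0" using Z0 direct_sum_commute by auto
  then show ?thesis unfolding add_obj_def by blast
qed

section \<open>Vanishing of arrows from add T to add T[1]\<close>

lemma add_obj_iff_Hom_to_shift:
  "X \<in> Ob C \<Longrightarrow> X \<in> add_obj C T \<longleftrightarrow> (\<forall>f \<in> Hom C X (ShO C T). f = Zer C X (ShO C T))"
  using max_orth Zer_in[OF _ ShO_in[OF T_Ob], of X]
  unfolding maximal_1_orthogonal_def Ext1_vanishes_def Ext1_def by blast

lemma add_obj_iff_Hom_from:
  "X \<in> Ob C \<Longrightarrow> X \<in> add_obj C T \<longleftrightarrow> (\<forall>f \<in> Hom C T (ShO C X). f = Zer C T (ShO C X))"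
  using max_orth Zer_in[OF T_Ob ShO_in, of X]
  unfolding maximal_1_orthogonal_def Ext1_vanishes_def Ext1_def by blast

text \<open>Vanishing of all arrows to \<open>ShO C T\<close> characterises
  \<open>add_obj C T\<close> and passes to retracts.\<close>

lemma retract_in_add_obj:
  assumes X: "X \<in> add_obj C T" and s: "s \<in> Hom C Y X" and r: "r \<in> Hom C X Y" and rs: "r \<cdot> s = Id C Y"
  shows "Y \<in> add_obj C T"
proof -
  have o: "X \<in> Ob C" "Y \<in> Ob C" using s Hom_Ob by blast+
  have "f = Zer C Y (ShO C T)" if f: "f \<in> Hom C Y (ShO C T)" for f
  proof -
    have "f = (f \<cdot> r) \<cdot> s" using Comp_assoc[OF s r f] rs Comp_Id[OF f] by simp
    also have "f \<cdot> r = Zer C X (ShO C T)"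
      using add_obj_iff_Hom_to_shift[OF o(1)] X Comp_in[OF r f] by blast
    finally show ?thesis using Zer_Comp[OF s ShO_in[OF T_Ob]] by simp
  qed
  then show ?thesis using add_obj_iff_Hom_to_shift[OF o(2)] by blast
qed

lemma zero_object_in_add_obj: "zero_object C Z \<Longrightarrow> Z \<in> add_obj C T"
  using add_obj_iff_Hom_to_shift[of Z] zero_object_Dom unfolding zero_object_def by blast

text \<open>Dual to \<open>add_obj_faithful\<close>: an arrow into a shifted sum of copies of
  \<open>T\<close> is determined by its components in \<open>ShO C T\<close>.\<close>

lemma zero_to_shift:
  assumes "Y \<in> add_obj C T" "g \<in> Hom C W (ShO C Y)"
    and "\<And>s. s \<in> Hom C Y T \<Longrightarrow> ShA C s \<cdot> g = Zer C W (ShO C T)"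
  shows "g = Zer C W (ShO C Y)"
  using assms
proof (induction arbitrary: g rule: add_obj_induct)
  case (zero Z) then show ?case using zero_object_Cod zero_object_ShO by blast
next
  case (sum Z V i1 i2 p1 p2)
  have h: "i1 \<in> Hom C V Z" "i2 \<in> Hom C T Z" "p1 \<in> Hom C Z V" "p2 \<in> Hom C Z T"
    using sum(2) unfolding biproduct_def by blast+
  note g = sum(3)
  have o: "W \<in> Ob C" "ShO C Z \<in> Ob C" using g Hom_Ob by blast+
  have "ShA C p1 \<cdot> g = Zer C W (ShO C V)"
  proof (rule sum(1)[OF Comp_in[OF g ShA_in[OF h(3)]]])
    fix s assume s: "s \<in> Hom C V T"
    show "ShA C s \<cdot> (ShA C p1 \<cdot> g) = Zer C W (ShO C T)"
      using sum(4)[OF Comp_in[OF h(3) s]] ShA_Comp[OF h(3) s]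
        Comp_assoc[OF g ShA_in[OF h(3)] ShA_in[OF s]] by simp
  qed
  moreover have "ShA C p2 \<cdot> g = Zer C W (ShO C T)" using sum(4)[OF h(4)] .
  ultimately show ?case
    using biproduct_decompose(1)[OF biproduct_ShA[OF sum(2)] g] Comp_Zer[OF ShA_in[OF h(1)] o(1)]
      Comp_Zer[OF ShA_in[OF h(2)] o(1)] Add_Zer[OF Zer_in[OF o]] by simp
next
  case (retract X Z i p)
  note i = retract(2) and p = retract(3) and g = retract(5)
  have o: "W \<in> Ob C" "X \<in> Ob C" using g i Hom_Ob by blast+
  have "ShA C i \<cdot> g = Zer C W (ShO C Z)"
  proof (rule retract(1)[OF Comp_in[OF g ShA_in[OF i]]])
    fix s assume s: "s \<in> Hom C Z T"
    show "ShA C s \<cdot> (ShA C i \<cdot> g) = Zer C W (ShO C T)"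
      using retract(6)[OF Comp_in[OF i s]] ShA_Comp[OF i s] Comp_assoc[OF g ShA_in[OF i] ShA_in[OF s]]
      by simp
  qed
  then show ?case
    using Comp_assoc[OF g ShA_in[OF i] ShA_in[OF p]] ShA_Comp[OF i p] retract(4) ShA_Id[OF o(2)]
      Id_Comp[OF g] Comp_Zer[OF ShA_in[OF p] o(1)] by simp
qed

lemma Hom_add_shift_zero:
  assumes X: "X \<in> add_obj C T" and Y: "Y \<in> add_obj C T" and f: "f \<in> Hom C X (ShO C Y)"
  shows "f = Zer C X (ShO C Y)"
  using zero_to_shift[OF Y f] add_obj_iff_Hom_to_shift[OF add_obj_Ob[OF X]] X Comp_in[OF f ShA_in]
  by blast

section \<open>Approximations by add T\<close>

definition T_epi :: "'o \<Rightarrow> 'o \<Rightarrow> 'a \<Rightarrow> bool"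
  where "T_epi X Y a \<longleftrightarrow> a \<in> Hom C X Y \<and> (\<forall>t \<in> Hom C T Y. \<exists>s \<in> Hom C T X. t = a \<cdot> s)"

lemma ex_approximation:
  assumes "X \<in> Ob C"
  obtains T0 a where "T0 \<in> add_obj C T" "T_epi T0 X a"
proof -
  have "contravariantly_finite C (add_obj C T)"
    using max_orth unfolding maximal_1_orthogonal_def by blast
  then obtain T0 a where "T0 \<in> add_obj C T" "a \<in> Hom C T0 X"
      "\<forall>S1 \<in> add_obj C T. \<forall>g \<in> Hom C S1 X. \<exists>h \<in> Hom C S1 T0. g = a \<cdot> h"
    using assms unfolding contravariantly_finite_def by blast
  then show ?thesis using that[of T0 a] T_in_add unfolding T_epi_def by blast
qed

text \<open>An arrow from \<open>T\<close> to K[1] dies in T0[1] by rigidity, hence comes from an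
  arrow to \<open>M\<close>. That arrow lifts through \<open>a\<close>, and
  \<open>w \<cdot> a\<close> is zero, so nothing remains.\<close>

lemma T_epi_triangle:
  assumes T0: "T0 \<in> add_obj C T" and a: "T_epi T0 M a" and tri: "dist_triangle C K T0 M k a w"
  shows "K \<in> add_obj C T"
proof -
  note h = dist_triangle_Hom[OF tri]
  have o: "K \<in> Ob C" using h(1) Hom_Ob by blast
  have "f = Zer C T (ShO C K)" if f: "f \<in> Hom C T (ShO C K)" for f
  proof -
    have "ShA C k \<cdot> f = Zer C T (ShO C T0)"
      using Hom_add_shift_zero[OF T_in_add T0 Comp_in[OF f ShA_in[OF h(1)]]] .
    then obtain g where g: "g \<in> Hom C T M" "f = w \<cdot> g"
      using dist_triangle_lift_shift[OF tri f] by blast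
    obtain s where s: "s \<in> Hom C T T0" "g = a \<cdot> s" using a g(1) unfolding T_epi_def by blast
    show ?thesis
      using g(2) s(2) Comp_assoc[OF s(1) h(2,3)] dist_triangle_comp_rotate(1)[OF tri]
        Zer_Comp[OF s(1) ShO_in[OF o]] by simp
  qed
  then show ?thesis using add_obj_iff_Hom_from[OF o] by blast
qed

lemma ex_presentation:
  assumes "X \<in> Ob C"
  obtains T0 T1 k a w where "T0 \<in> add_obj C T" "T1 \<in> add_obj C T" "T_epi T0 X a"
    "dist_triangle C T1 T0 X k a w"
proof -
  obtain T0 a where T0: "T0 \<in> add_obj C T" "T_epi T0 X a" using ex_approximation[OF assms] .
  obtain T1 k w where "dist_triangle C T1 T0 X k a w"
    using ex_dist_triangle_middle T0(2) unfolding T_epi_def by blast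
  with T0 T_epi_triangle that show ?thesis by blast
qed

section \<open>The kernel of \<open>k\<close> on arrows from \<open>T\<close>, and the factorization
  ideal\<close>

definition T_mono :: "'o \<Rightarrow> 'o \<Rightarrow> 'a \<Rightarrow> bool"
  where "T_mono X Y k \<longleftrightarrow> k \<in> Hom C X Y \<and> (\<forall>t \<in> Hom C T X. k \<cdot> t = Zer C T Y \<longrightarrow> t = Zer C T X)"

lemma T_mono_if_factorization_zero:
  assumes K: "K \<in> add_obj C T" and tri: "dist_triangle C K T0 M k a w"
    and zero: "\<And>g h. g \<in> Hom C (ShO C T) M \<Longrightarrow> h \<in> Hom C M (ShO C T) \<Longrightarrow>
      h \<cdot> g = Zer C (ShO C T) (ShO C T)"
  shows "T_mono K T0 k"
  unfolding T_mono_def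
proof (intro conjI ballI impI)
  note h = dist_triangle_Hom[OF tri]
  show "k \<in> Hom C K T0" by (rule h(1))
  fix x assume x: "x \<in> Hom C T K" and "k \<cdot> x = Zer C T T0"
  then have "ShA C k \<cdot> ShA C x = Zer C (ShO C T) (ShO C T0)"
    using ShA_Comp[OF x h(1)] ShA_Zer[OF T_Ob, of T0] Hom_Ob[OF h(1)] by simp
  then obtain g where g: "g \<in> Hom C (ShO C T) M" "ShA C x = w \<cdot> g"
    using dist_triangle_lift_shift[OF tri ShA_in[OF x]] by blast
  \<comment> \<open>Every component of \<open>w \<cdot> g\<close> in \<open>ShO C T\<close> is a
    composite from \<open>ShO C T\<close> through \<open>M\<close> back to \<open>ShO C T\<close>,
    so it is covered by \<open>zero\<close>.\<close>
  have "ShA C x = Zer C (ShO C T) (ShO C K)"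
  proof (rule zero_to_shift[OF K ShA_in[OF x]])
    fix s assume s: "s \<in> Hom C K T"
    show "ShA C s \<cdot> ShA C x = Zer C (ShO C T) (ShO C T)"
      using zero[OF g(1) Comp_in[OF h(3) ShA_in[OF s]]] Comp_assoc[OF g(1) h(3) ShA_in[OF s]] g(2)
      by simp
  qed
  then show "x = Zer C T K" using ShA_eq_Zer_iff[OF x] by simp
qed

lemma factorization_zero_if_T_mono:
  assumes T0: "T0 \<in> add_obj C T"
    and tri: "dist_triangle C K T0 M k a w" and k: "T_mono K T0 k"
    and g: "g \<in> Hom C (ShO C T) M" and h: "h \<in> Hom C M (ShO C T)"
  shows "h \<cdot> g = Zer C (ShO C T) (ShO C T)"
proof -
  note th = dist_triangle_Hom[OF tri]
  have o: "K \<in> Ob C" "T0 \<in> Ob C" using th Hom_Ob by blast+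
  have "h \<cdot> a = Zer C T0 (ShO C T)"
    using Hom_add_shift_zero[OF T0 T_in_add Comp_in[OF th(2) h]] .
  then obtain h' where h': "h' \<in> Hom C (ShO C K) (ShO C T)" "h = h' \<cdot> w"
    using dist_triangle_extend[OF dist_triangle_rotate[OF tri] h] by blast
  \<comment> \<open>The shifted \<open>k\<close> kills \<open>w\<close>, so the unshifted form
    \<open>x\<close> of \<open>w \<cdot> g\<close> lies in the kernel that \<open>T_mono\<close>
    makes trivial.\<close>
  obtain x where x: "x \<in> Hom C T K" "w \<cdot> g = ShA C x"
    using ShA_surj[OF T_Ob o(1) Comp_in[OF g th(3)]] .
  have "ShA C (k \<cdot> x) = Zer C (ShO C T) (ShO C T0)"
    using ShA_Comp[OF x(1) th(1)] x(2) Comp_assoc[OF g th(3) ShA_in[OF th(1)]]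
      dist_triangle_comp_rotate(2)[OF tri] Zer_Comp[OF g ShO_in[OF o(2)]] by simp
  then have "k \<cdot> x = Zer C T T0" using ShA_eq_Zer_iff[OF Comp_in[OF x(1) th(1)]] by simp
  then have "x = Zer C T K" using k x(1) unfolding T_mono_def by blast
  then show ?thesis
    using h'(2) Comp_assoc[OF g th(3) h'(1)] x(2) ShA_Zer[OF T_Ob o(1)]
      Comp_Zer[OF h'(1) ShO_in[OF T_Ob]] by simp
qed

text \<open>An idempotent of \<open>K\<close> killed by \<open>k\<close> splits off a summand \<open>Y[1]\<close> of the cone \<open>M\<close>.\<close>

lemma idempotent_zero_if_indecomposable:
  assumes split: "idempotents_split_on C (add_obj C T)"
    and M: "indecomposable C M" "M \<notin> add_obj C (ShO C T)"
    and K: "K \<in> add_obj C T" and tri: "dist_triangle C K T0 M k a w"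
    and e: "e \<in> Hom C K K" "e \<cdot> e = e" and ke: "k \<cdot> e = Zer C K T0"
  shows "e = Zer C K K"
proof -
  note th = dist_triangle_Hom[OF tri]
  obtain Y r s where Y: "Y \<in> Ob C" and r: "r \<in> Hom C K Y" and s: "s \<in> Hom C Y K"
    and rs: "r \<cdot> s = Id C Y" and sr: "s \<cdot> r = e"
    using split K e unfolding idempotents_split_on_def by blast
  have oK: "K \<in> Ob C" using r Hom_Ob by blast
  note r' = ShA_in[OF r] and s' = ShA_in[OF s] and e' = ShA_in[OF e(1)]
  \<comment> \<open>Exactness at K[1] lets the shift of \<open>e\<close> factor through
    \<open>w\<close>; this carries the summand of K[1] over to \<open>M\<close>.\<close>
  have "ShA C k \<cdot> ShA C e = Zer C (ShO C K) (ShO C T0)"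
    using ShA_Comp[OF e(1) th(1)] ke ShA_Zer[OF oK, of T0] Hom_Ob[OF th(1)] by simp
  then obtain t where t: "t \<in> Hom C (ShO C K) M" "ShA C e = w \<cdot> t"
    using dist_triangle_lift_shift[OF tri e'] by blast
  note ts = Comp_in[OF s' t(1)] and rw = Comp_in[OF th(3) r']
  have es: "e \<cdot> s = s" using sr Comp_assoc[OF s r s] rs Comp_Id[OF s] by simp
  have "(ShA C r \<cdot> w) \<cdot> (t \<cdot> ShA C s) = ShA C r \<cdot> ((w \<cdot> t) \<cdot> ShA C s)"
    using Comp_assoc[OF ts th(3) r'] Comp_assoc[OF s' t(1) th(3)] by simp
  also have "\<dots> = ShA C r \<cdot> ShA C (e \<cdot> s)"
    using t(2) ShA_Comp[OF s e(1)] by simp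
  also have "\<dots> = Id C (ShO C Y)"
    using es ShA_Comp[OF s r] rs ShA_Id[OF Y] by simp
  finally have rts: "(ShA C r \<cdot> w) \<cdot> (t \<cdot> ShA C s) = Id C (ShO C Y)" .
  obtain W where W: "direct_sum C M (ShO C Y) W" using split_mono_direct_sum[OF ts rw rts] .
  \<comment> \<open>With a zero complement, \<open>M\<close> would be a retract of Y[1] with
    \<open>Y\<close> in add T, which is excluded. Indecomposability then leaves only Y[1] =
    0.\<close>
  have nW: "\<not> zero_object C W"
  proof
    assume z: "zero_object C W"
    obtain i1 i2 p1 p2 where b: "biproduct M (ShO C Y) W i1 i2 p1 p2"
      using W direct_sum_iff by blast
    then have h: "i1 \<in> Hom C (ShO C Y) M" "i2 \<in> Hom C W M" "p1 \<in> Hom C M (ShO C Y)" "p2 \<in> Hom C M W"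
      and sm: "Add C (i1 \<cdot> p1) (i2 \<cdot> p2) = Id C M"
      unfolding biproduct_def by blast+
    have "i2 \<cdot> p2 = Zer C M M"
      using zero_object_Dom[OF z h(2)] Zer_Comp[OF h(4), of M] Hom_Ob[OF h(4)] by simp
    then have "i1 \<cdot> p1 = Id C M" using sm Add_Zer[OF Comp_in[OF h(3,1)]] by simp
    then show False
      using retract_ShO_in_add_obj[OF retract_in_add_obj[OF K s r rs] h(3,1)] M(2) by blast
  qed
  then have "zero_object C (ShO C Y)" using M(1) W unfolding indecomposable_def by blast
  then have "Id C (ShO C Y) = Zer C (ShO C Y) (ShO C Y)" by (simp add: zero_object_def)
  then have "Id C Y = Zer C Y Y" using ShA_Id[OF Y] ShA_eq_Zer_iff[OF Id_in[OF Y]] by simp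
  then have "r = Zer C K Y" using Id_Comp[OF r] Zer_Comp[OF r Y] by simp
  then show ?thesis using sr Comp_Zer[OF s oK] by simp
qed

section \<open>Splitting of kernels along a finite complex\<close>

definition T_exact :: "'o \<Rightarrow> 'o \<Rightarrow> 'o \<Rightarrow> 'a \<Rightarrow> 'a \<Rightarrow> bool"
  where "T_exact X Y Z f g \<longleftrightarrow> f \<in> Hom C X Y \<and> g \<in> Hom C Y Z \<and> g \<cdot> f = Zer C X Z \<and>
    (\<forall>t \<in> Hom C T Y. g \<cdot> t = Zer C T Z \<longrightarrow> (\<exists>s \<in> Hom C T X. t = f \<cdot> s))"

text \<open>The two conditions make \<open>e\<close> act on arrows from \<open>T\<close> as a
  projection onto the kernel of \<open>u\<close>. For \<open>X\<close> in add T, idempotence of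
  \<open>e\<close> itself follows by faithfulness.\<close>

definition T_kernel_splits :: "'o \<Rightarrow> 'o \<Rightarrow> 'a \<Rightarrow> bool"
  where "T_kernel_splits X Y u \<longleftrightarrow> (\<exists>e \<in> Hom C X X. u \<cdot> e = Zer C X Y \<and>
    (\<forall>t \<in> Hom C T X. u \<cdot> t = Zer C T Y \<longrightarrow> e \<cdot> t = t))"

text \<open>This is the vanishing of \<open>Ext\<^sup>2\<close> into projective modules (projectives have injective
  dimension at most 1). With \<open>X\<close> the cone of \<open>u1\<close>, the induced map \<open>v : X \<rightarrow> A0\<close> is
  injective on \<open>Hom(T, _)\<close>, so its cocone maps to \<open>X\<close> through \<open>add T[1]\<close>. Hence the connecting map
  \<open>X \<rightarrow> A2[1]\<close>, corrected by \<open>1 - e\<close>, vanishes there, so it factors through \<open>A0\<close> and is zero.\<close>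

lemma T_kernel_splits_step:
  assumes A: "A2 \<in> add_obj C T" "A1 \<in> add_obj C T" "A0 \<in> add_obj C T"
    and ex: "T_exact A2 A1 A0 u1 u0" and sp: "T_kernel_splits A2 A1 u1"
  shows "T_kernel_splits A1 A0 u0"
proof -
  have u1: "u1 \<in> Hom C A2 A1" and u0: "u0 \<in> Hom C A1 A0" and uu: "u0 \<cdot> u1 = Zer C A2 A0"
    and exact: "\<And>t. t \<in> Hom C T A1 \<Longrightarrow> u0 \<cdot> t = Zer C T A0 \<Longrightarrow> \<exists>s \<in> Hom C T A2. t = u1 \<cdot> s"
    using ex unfolding T_exact_def by blast+
  obtain e where e: "e \<in> Hom C A2 A2" and u1e: "u1 \<cdot> e = Zer C A2 A1"
    and et: "\<And>t. t \<in> Hom C T A2 \<Longrightarrow> u1 \<cdot> t = Zer C T A1 \<Longrightarrow> e \<cdot> t = t"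
    using sp unfolding T_kernel_splits_def by blast
  have o: "A2 \<in> Ob C" "A1 \<in> Ob C" "A0 \<in> Ob C" using u1 u0 Hom_Ob by blast+
  obtain X q w where tX: "dist_triangle C A2 A1 X u1 q w" using TR1_cone[OF o(1,2) u1] by blast
  note h = dist_triangle_Hom[OF tX]
  have oX: "X \<in> Ob C" using h Hom_Ob by blast
  obtain v where v: "v \<in> Hom C X A0" "u0 = v \<cdot> q" using dist_triangle_extend[OF tX u0 uu] .
  \<comment> \<open>By rigidity every arrow from \<open>T\<close> to the cone \<open>X\<close> lifts
    to \<open>A1\<close>; exactness there then gives injectivity of \<open>v\<close>.\<close>
  have vmono: "x = Zer C T X" if x: "x \<in> Hom C T X" and vx: "v \<cdot> x = Zer C T A0" for x
  proof -
    have "w \<cdot> x = Zer C T (ShO C A2)"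
      using Hom_add_shift_zero[OF T_in_add A(1) Comp_in[OF x h(3)]] .
    then obtain t where t: "t \<in> Hom C T A1" "x = q \<cdot> t"
      using dist_triangle_lift[OF dist_triangle_rotate[OF tX] x] by blast
    have "u0 \<cdot> t = Zer C T A0" using v(2) Comp_assoc[OF t(1) h(2) v(1)] t(2) vx by simp
    then obtain s where s: "s \<in> Hom C T A2" "t = u1 \<cdot> s" using exact[OF t(1)] by blast
    show ?thesis
      using t(2) s(2) Comp_assoc[OF s(1) h(1,2)] dist_triangle_comp[OF tX] Zer_Comp[OF s(1) oX] by simp
  qed
  obtain Y y z where tY: "dist_triangle C Y X A0 y v z" using ex_dist_triangle_middle[OF v(1)] .
  note hY = dist_triangle_Hom[OF tY]
  have oY: "Y \<in> Ob C" using hY Hom_Ob by blast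
  obtain B0 B1 b c d where B: "B0 \<in> add_obj C T" "B1 \<in> add_obj C T"
    and tB: "dist_triangle C B1 B0 Y b c d"
    using ex_presentation[OF oY] by metis
  note hB = dist_triangle_Hom[OF tB]
  have oB: "B0 \<in> Ob C" "B1 \<in> Ob C" using hB Hom_Ob by blast+
  \<comment> \<open>Tested on arrows from \<open>T\<close>: \<open>v\<close> kills \<open>y\<close>
    and is injective on them. Hence \<open>y\<close> factors through \<open>d\<close>, that is,
    through the shift of \<open>B1\<close>.\<close>
  have "y \<cdot> c = Zer C B0 X"
  proof (rule add_obj_faithful[OF B(1) Comp_in[OF hB(2) hY(1)] Zer_in[OF oB(1) oX]])
    fix t assume t: "t \<in> Hom C T B0"
    note ct = Comp_in[OF t hB(2)]
    have "v \<cdot> (y \<cdot> (c \<cdot> t)) = Zer C T A0"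
      using Comp_assoc[OF ct hY(1,2)] dist_triangle_comp[OF tY] Zer_Comp[OF ct o(3)] by simp
    then show "(y \<cdot> c) \<cdot> t = Zer C B0 X \<cdot> t"
      using vmono[OF Comp_in[OF ct hY(1)]] Comp_assoc[OF t hB(2) hY(1)] Zer_Comp[OF t oX] by simp
  qed
  then obtain y' where y': "y' \<in> Hom C (ShO C B1) X" "y = y' \<cdot> d"
    using dist_triangle_extend[OF dist_triangle_rotate[OF tB] hY(1)] by blast
  \<comment> \<open>Unshifting makes \<open>e\<close> applicable: \<open>f\<close> lands in the
    kernel of \<open>u1\<close>, where \<open>e\<close> is the identity, so \<open>1 - e\<close>
    annihilates it.\<close>
  obtain f where f: "f \<in> Hom C B1 A2" "w \<cdot> y' = ShA C f"
    using ShA_surj[OF oB(2) o(1) Comp_in[OF y'(1) h(3)]] .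
  have "ShA C (u1 \<cdot> f) = Zer C (ShO C B1) (ShO C A1)"
    using ShA_Comp[OF f(1) u1] f(2) Comp_assoc[OF y'(1) h(3) ShA_in[OF u1]]
      dist_triangle_comp_rotate(2)[OF tX] Zer_Comp[OF y'(1) ShO_in[OF o(2)]] by simp
  then have u1f: "u1 \<cdot> f = Zer C B1 A1" using ShA_eq_Zer_iff[OF Comp_in[OF f(1) u1]] by simp
  have ef: "e \<cdot> f = f"
  proof (rule add_obj_faithful[OF B(2) Comp_in[OF f(1) e] f(1)])
    fix t assume t: "t \<in> Hom C T B1"
    have "u1 \<cdot> (f \<cdot> t) = Zer C T A1" using Comp_assoc[OF t f(1) u1] u1f Zer_Comp[OF t o(2)] by simp
    then show "(e \<cdot> f) \<cdot> t = f \<cdot> t" using et[OF Comp_in[OF t f(1)]] Comp_assoc[OF t f(1) e] by simp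
  qed
  define g where "g = Sub (Id C A2) e"
  note i = Id_in[OF o(1)]
  have g: "g \<in> Hom C A2 A2" unfolding g_def using Sub_in[OF i e] .
  note gw = Comp_in[OF h(3) ShA_in[OF g]]
  have gf: "g \<cdot> f = Zer C B1 A2"
    unfolding g_def using Sub_Comp[OF f(1) i e] ef Id_Comp[OF f(1)] Sub_self[OF f(1)] by simp
  have "(ShA C g \<cdot> w) \<cdot> y = ((ShA C g \<cdot> w) \<cdot> y') \<cdot> d"
    using y'(2) Comp_assoc[OF hB(3) y'(1) gw] by simp
  also have "(ShA C g \<cdot> w) \<cdot> y' = Zer C (ShO C B1) (ShO C A2)"
    using Comp_assoc[OF y'(1) h(3) ShA_in[OF g]] f(2) ShA_Comp[OF f(1) g] gf ShA_Zer[OF oB(2) o(1)]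
    by simp
  finally have "(ShA C g \<cdot> w) \<cdot> y = Zer C Y (ShO C A2)"
    using Zer_Comp[OF hB(3) ShO_in[OF o(1)]] by simp
  then obtain l where l: "l \<in> Hom C A0 (ShO C A2)" "ShA C g \<cdot> w = l \<cdot> v"
    using dist_triangle_extend[OF tY gw] by blast
  have "l = Zer C A0 (ShO C A2)" using Hom_add_shift_zero[OF A(3,1) l(1)] .
  then have "ShA C g \<cdot> w = Zer C X (ShO C A2)" using l(2) Zer_Comp[OF v(1) ShO_in[OF o(1)]] by simp
  then obtain j where j: "j \<in> Hom C A1 A2" "g = j \<cdot> u1"
    using dist_triangle_extend_shift[OF tX g] by blast
  have "u1 \<cdot> g = u1"
    unfolding g_def using Comp_Sub[OF i e u1] Comp_Id[OF u1] u1e Sub_Zer[OF u1] by simp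
  \<comment> \<open>Thus \<open>u1 \<cdot> j\<close> fixes the image of \<open>u1\<close>, which on
    arrows from \<open>T\<close> is the kernel of \<open>u0\<close>; it is the projection
    sought.\<close>
  then have uju: "u1 \<cdot> (j \<cdot> u1) = u1" using j(2) by simp
  show ?thesis
    unfolding T_kernel_splits_def
  proof (intro bexI conjI ballI impI)
    show uj: "u1 \<cdot> j \<in> Hom C A1 A1" using Comp_in[OF j(1) u1] .
    show "u0 \<cdot> (u1 \<cdot> j) = Zer C A1 A0"
      using Comp_assoc[OF j(1) u1 u0] uu Zer_Comp[OF j(1) o(3)] by simp
    fix t assume "t \<in> Hom C T A1" "u0 \<cdot> t = Zer C T A0"
    then obtain s where s: "s \<in> Hom C T A2" "t = u1 \<cdot> s" using exact by blast
    show "(u1 \<cdot> j) \<cdot> t = t"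
      using s(2) Comp_assoc[OF s(1) u1 uj] Comp_assoc[OF u1 j(1) u1] uju by simp
  qed
qed

text \<open>At the zero object \<open>A (Suc n)\<close> the zero endomorphism is a splitting;
  descending induction on the degree carries it down.\<close>

lemma T_kernel_splits_finite:
  assumes A: "\<And>i. A i \<in> add_obj C T"
    and ex: "\<And>i. T_exact (A (Suc (Suc i))) (A (Suc i)) (A i) (u (Suc i)) (u i)"
    and zero: "\<And>i. i > n \<Longrightarrow> zero_object C (A i)"
  shows "T_kernel_splits (A 1) (A 0) (u 0)"
proof -
  have u: "u i \<in> Hom C (A (Suc i)) (A i)" for i using ex[of i] unfolding T_exact_def by blast
  have top: "T_kernel_splits (A (Suc n)) (A n) (u n)"
  proof -
    have z: "zero_object C (A (Suc n))" using zero[of "Suc n"] by simp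
    then have "A (Suc n) \<in> Ob C" by (simp add: zero_object_def)
    then have "Zer C (A (Suc n)) (A (Suc n)) \<in> Hom C (A (Suc n)) (A (Suc n))"
      "u n \<cdot> Zer C (A (Suc n)) (A (Suc n)) = Zer C (A (Suc n)) (A n)"
      using Zer_in Comp_Zer[OF u] by blast+
    moreover have "Zer C (A (Suc n)) (A (Suc n)) \<cdot> t = t" if "t \<in> Hom C T (A (Suc n))" for t
      using zero_object_Cod[OF z that] Zer_Comp[OF that] Hom_Ob[OF that] by simp
    ultimately show ?thesis unfolding T_kernel_splits_def by blast
  qed
  have "T_kernel_splits (A (Suc m)) (A m) (u m)" if "m \<le> n" for m
    using that
  proof (induction m rule: inc_induct)
    case base
    show ?case by (rule top)
  next
    case (step m)
    then show ?case using T_kernel_splits_step[OF A A A ex] by blast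
  qed
  from this[of 0] show ?thesis by simp
qed

text \<open>Both \<open>A1\<close> and \<open>K\<close> cover the kernel of \<open>a\<close> on
  arrows from \<open>T\<close>. Comparing the covers yields an endomorphism \<open>p\<close> of
  \<open>K\<close> over \<open>A0\<close> that annihilates the kernel of \<open>k\<close>, so
  \<open>1 - p\<close> is the idempotent with that kernel as its image.\<close>

lemma T_mono_if_kernel_splits:
  assumes split: "idempotents_split_on C (add_obj C T)"
    and M: "indecomposable C M" "M \<notin> add_obj C (ShO C T)"
    and A: "A0 \<in> add_obj C T" "A1 \<in> add_obj C T"
    and a: "T_epi A0 M a" and ex: "T_exact A1 A0 M u a" and sp: "T_kernel_splits A1 A0 u"
    and tri: "dist_triangle C K A0 M k a w"
  shows "T_mono K A0 k"
proof -
  note th = dist_triangle_Hom[OF tri]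
  have K: "K \<in> add_obj C T" using T_epi_triangle[OF A(1) a tri] .
  have u: "u \<in> Hom C A1 A0" and au: "a \<cdot> u = Zer C A1 M"
    and exact: "\<And>t. t \<in> Hom C T A0 \<Longrightarrow> a \<cdot> t = Zer C T M \<Longrightarrow> \<exists>s \<in> Hom C T A1. t = u \<cdot> s"
    using ex unfolding T_exact_def by blast+
  have o: "A0 \<in> Ob C" "A1 \<in> Ob C" "K \<in> Ob C" "M \<in> Ob C" using u th Hom_Ob by blast+
  obtain e where e: "e \<in> Hom C A1 A1" and ue: "u \<cdot> e = Zer C A1 A0"
    and et: "\<And>t. t \<in> Hom C T A1 \<Longrightarrow> u \<cdot> t = Zer C T A0 \<Longrightarrow> e \<cdot> t = t"
    using sp unfolding T_kernel_splits_def by blast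
  obtain f where f: "f \<in> Hom C A1 K" "u = k \<cdot> f" using dist_triangle_lift[OF tri u au] .
  have "\<exists>g \<in> Hom C K A1. k = u \<cdot> g"
  proof (rule add_obj_factor[OF K u th(1)])
    fix t assume t: "t \<in> Hom C T K"
    have "a \<cdot> (k \<cdot> t) = Zer C T M"
      using Comp_assoc[OF t th(1,2)] dist_triangle_comp[OF tri] Zer_Comp[OF t o(4)] by simp
    then show "\<exists>s \<in> Hom C T A1. k \<cdot> t = u \<cdot> s" using exact[OF Comp_in[OF t th(1)]] by blast
  qed
  then obtain g where g: "g \<in> Hom C K A1" "k = u \<cdot> g" by blast
  define e' where "e' = Sub (Id C A1) e"
  note i1 = Id_in[OF o(2)] and iK = Id_in[OF o(3)]
  have e': "e' \<in> Hom C A1 A1" unfolding e'_def using Sub_in[OF i1 e] .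
  have ue': "u \<cdot> e' = u"
    unfolding e'_def using Comp_Sub[OF i1 e u] Comp_Id[OF u] ue Sub_Zer[OF u] by simp
  \<comment> \<open>The factor \<open>e'\<close> discards the kernel of \<open>u\<close>, to which
    \<open>g\<close> sends the kernel of \<open>k\<close>; as \<open>u \<cdot> e' = u\<close>, the
    composite with \<open>k\<close> is unchanged.\<close>
  define p where "p = f \<cdot> (e' \<cdot> g)"
  note e'g = Comp_in[OF g(1) e']
  have p: "p \<in> Hom C K K" unfolding p_def using Comp_in[OF e'g f(1)] .
  have kp: "k \<cdot> p = k"
    unfolding p_def
    using Comp_assoc[OF e'g f(1) th(1)] Comp_assoc[OF g(1) e' u] ue' f(2)[symmetric] g(2)[symmetric]
    by simp
  have px: "p \<cdot> x = Zer C T K" if x: "x \<in> Hom C T K" and kx: "k \<cdot> x = Zer C T A0" for x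
  proof -
    note gx = Comp_in[OF x g(1)]
    have "u \<cdot> (g \<cdot> x) = Zer C T A0" using Comp_assoc[OF x g(1) u] g(2) kx by simp
    then have "e' \<cdot> (g \<cdot> x) = Zer C T A1"
      unfolding e'_def using et[OF gx] Sub_Comp[OF gx i1 e] Id_Comp[OF gx] Sub_self[OF gx] by simp
    then show ?thesis
      unfolding p_def using Comp_assoc[OF x e'g f(1)] Comp_assoc[OF x g(1) e'] Comp_Zer[OF f(1) T_Ob]
      by simp
  qed
  define q where "q = Sub (Id C K) p"
  have q: "q \<in> Hom C K K" unfolding q_def using Sub_in[OF iK p] .
  have kq: "k \<cdot> q = Zer C K A0"
    unfolding q_def using Comp_Sub[OF iK p th(1)] Comp_Id[OF th(1)] kp Sub_self[OF th(1)] by simp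
  have qx: "q \<cdot> x = x" if x: "x \<in> Hom C T K" and kx: "k \<cdot> x = Zer C T A0" for x
    unfolding q_def using Sub_Comp[OF x iK p] Id_Comp[OF x] px[OF x kx] Sub_Zer[OF x] by simp
  have "q \<cdot> q = q"
  proof (rule add_obj_faithful[OF K Comp_in[OF q q] q])
    fix t assume t: "t \<in> Hom C T K"
    show "(q \<cdot> q) \<cdot> t = q \<cdot> t"
      using Comp_assoc[OF t q q] qx[OF Comp_in[OF t q]] Comp_assoc[OF t q th(1)] kq Zer_Comp[OF t o(1)]
      by simp
  qed
  then have q0: "q = Zer C K K"
    using idempotent_zero_if_indecomposable[OF split M K tri q _ kq] by blast
  show ?thesis
    unfolding T_mono_def
  proof (intro conjI ballI impI)
    show "k \<in> Hom C K A0" by (rule th(1))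
    fix t assume t: "t \<in> Hom C T K" "k \<cdot> t = Zer C T A0"
    show "t = Zer C T K" using qx[OF t] q0 Zer_Comp[OF t(1) o(3)] by simp
  qed
qed

end

section \<open>Right modules\<close>

lemma rmod_homD:
  assumes "f \<in> rmod_hom R A B"
  shows "x \<in> carrier A \<Longrightarrow> f x \<in> carrier B"
    and "x \<in> carrier A \<Longrightarrow> y \<in> carrier A \<Longrightarrow> f (x \<oplus>\<^bsub>A\<^esub> y) = f x \<oplus>\<^bsub>B\<^esub> f y"
    and "r \<in> carrier R \<Longrightarrow> x \<in> carrier A \<Longrightarrow> f (r \<odot>\<^bsub>A\<^esub> x) = r \<odot>\<^bsub>B\<^esub> f x"
  using assms unfolding rmod_hom_def by auto

lemma rmod_homI:
  assumes "\<And>x. x \<in> carrier A \<Longrightarrow> f x \<in> carrier B"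
    and "\<And>x y. x \<in> carrier A \<Longrightarrow> y \<in> carrier A \<Longrightarrow> f (x \<oplus>\<^bsub>A\<^esub> y) = f x \<oplus>\<^bsub>B\<^esub> f y"
    and "\<And>r x. r \<in> carrier R \<Longrightarrow> x \<in> carrier A \<Longrightarrow> f (r \<odot>\<^bsub>A\<^esub> x) = r \<odot>\<^bsub>B\<^esub> f x"
  shows "f \<in> rmod_hom R A B"
  using assms unfolding rmod_hom_def by auto

lemma rmod_hom_comp:
  assumes "f \<in> rmod_hom R A B" "g \<in> rmod_hom R B D"
  shows "(\<lambda>x. g (f x)) \<in> rmod_hom R A D"
  by (rule rmod_homI) (simp_all add: rmod_homD[OF assms(1)] rmod_homD[OF assms(2)])

lemma rmod_hom_id: "(\<lambda>x. x) \<in> rmod_hom R A A"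
  by (rule rmod_homI) auto

lemma rmod_hom_zero:
  assumes "right_module R A" "right_module R B" "f \<in> rmod_hom R A B"
  shows "f \<zero>\<^bsub>A\<^esub> = \<zero>\<^bsub>B\<^esub>"
proof -
  interpret A: right_module R A by fact
  interpret B: right_module R B by fact
  have "f \<zero>\<^bsub>A\<^esub> \<oplus>\<^bsub>B\<^esub> f \<zero>\<^bsub>A\<^esub> = f \<zero>\<^bsub>A\<^esub>"
    using rmod_homD(2)[OF assms(3) A.M.zero_closed A.M.zero_closed] by simp
  then show ?thesis
    using B.M.add.r_cancel_one'[of "f \<zero>\<^bsub>A\<^esub>" "f \<zero>\<^bsub>A\<^esub>"] rmod_homD(1)[OF assms(3) A.M.zero_closed]
    by simp
qed

lemma (in right_module) smult_zero:
  assumes "r \<in> carrier R"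
  shows "r \<odot>\<^bsub>M\<^esub> \<zero>\<^bsub>M\<^esub> = \<zero>\<^bsub>M\<^esub>"
proof -
  have "r \<odot>\<^bsub>M\<^esub> \<zero>\<^bsub>M\<^esub> \<oplus>\<^bsub>M\<^esub> r \<odot>\<^bsub>M\<^esub> \<zero>\<^bsub>M\<^esub> = r \<odot>\<^bsub>M\<^esub> \<zero>\<^bsub>M\<^esub>"
    using smult_r_distr[OF assms M.zero_closed M.zero_closed] by simp
  then show ?thesis
    using M.add.r_cancel_one'[of "r \<odot>\<^bsub>M\<^esub> \<zero>\<^bsub>M\<^esub>" "r \<odot>\<^bsub>M\<^esub> \<zero>\<^bsub>M\<^esub>"]
      smult_closed[OF assms M.zero_closed] by simp
qed

lemma rmod_hom_const_zero:
  assumes "right_module R B"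
  shows "(\<lambda>x. \<zero>\<^bsub>B\<^esub>) \<in> rmod_hom R A B"
proof -
  interpret B: right_module R B by fact
  show ?thesis by (rule rmod_homI) (simp_all add: B.smult_zero)
qed

lemma rmod_hom_add:
  assumes "right_module R B" "f \<in> rmod_hom R A B" "g \<in> rmod_hom R A B"
  shows "(\<lambda>x. f x \<oplus>\<^bsub>B\<^esub> g x) \<in> rmod_hom R A B"
proof -
  interpret B: right_module R B by fact
  show ?thesis
    by (rule rmod_homI)
      (simp_all add: rmod_homD[OF assms(2)] rmod_homD[OF assms(3)] B.M.a_ac B.smult_r_distr)
qed

lemma rmod_hom_inverse:
  assumes "right_module R A" "f \<in> rmod_hom R A B" "bij_betw f (carrier A) (carrier B)"
  shows "inv_into (carrier A) f \<in> rmod_hom R B A"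
proof -
  interpret A: right_module R A by fact
  let ?g = "inv_into (carrier A) f"
  have g: "?g y \<in> carrier A" "f (?g y) = y" if "y \<in> carrier B" for y
    using that bij_betw_inv_into_right[OF assms(3)] bij_betw_apply[OF bij_betw_inv_into[OF assms(3)]]
    by auto
  have gf: "?g (f x) = x" if "x \<in> carrier A" for x
    using that bij_betw_inv_into_left[OF assms(3)] by simp
  show ?thesis
  proof (rule rmod_homI)
    fix x y assume xy: "x \<in> carrier B" "y \<in> carrier B"
    show "?g (x \<oplus>\<^bsub>B\<^esub> y) = ?g x \<oplus>\<^bsub>A\<^esub> ?g y"
      using gf[of "?g x \<oplus>\<^bsub>A\<^esub> ?g y"] rmod_homD(2)[OF assms(2), of "?g x" "?g y"] g[OF xy(1)] g[OF xy(2)]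
      by simp
  next
    fix r x assume rx: "r \<in> carrier R" "x \<in> carrier B"
    show "?g (r \<odot>\<^bsub>B\<^esub> x) = r \<odot>\<^bsub>A\<^esub> ?g x"
      using gf[of "r \<odot>\<^bsub>A\<^esub> ?g x"] rmod_homD(3)[OF assms(2), of r "?g x"] g[OF rx(2)] rx
        A.smult_closed by simp
  qed (use g in blast)
qed

text \<open>Moves a module along an injection into another carrier type, as \<open>mod_fp\<close>
  fixes that type.\<close>

definition transport :: "('x \<Rightarrow> 'y) \<Rightarrow> ('r, 'x, 'l) module_scheme \<Rightarrow> ('r, 'y) module"
  where "transport e N =
    \<lparr>carrier = e ` carrier N, monoid.mult = undefined, one = undefined, zero = e \<zero>\<^bsub>N\<^esub>,
     add = (\<lambda>x y. e (the_inv e x \<oplus>\<^bsub>N\<^esub> the_inv e y)), smult = (\<lambda>r x. e (r \<odot>\<^bsub>N\<^esub> the_inv e x))\<rparr>"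

lemma transport_simps:
  "carrier (transport e N) = e ` carrier N"
  "\<zero>\<^bsub>transport e N\<^esub> = e \<zero>\<^bsub>N\<^esub>"
  "inj e \<Longrightarrow> e x \<oplus>\<^bsub>transport e N\<^esub> e y = e (x \<oplus>\<^bsub>N\<^esub> y)"
  "inj e \<Longrightarrow> r \<odot>\<^bsub>transport e N\<^esub> e x = e (r \<odot>\<^bsub>N\<^esub> x)"
  by (simp_all add: transport_def the_inv_f_f)

lemma right_module_transport:
  assumes "right_module R N" "inj e"
  shows "right_module R (transport e N)"
proof -
  interpret N: right_module R N by fact
  note s = transport_simps(1,2) transport_simps(3,4)[OF assms(2)]
  have "abelian_group (transport e N)"
  proof (rule abelian_groupI)
    fix x assume "x \<in> carrier (transport e N)"
    then obtain y where y: "y \<in> carrier N" "x = e y" by (auto simp: s)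
    then have "e (\<ominus>\<^bsub>N\<^esub> y) \<oplus>\<^bsub>transport e N\<^esub> x = \<zero>\<^bsub>transport e N\<^esub>" by (simp add: s N.M.l_neg)
    then show "\<exists>z \<in> carrier (transport e N). z \<oplus>\<^bsub>transport e N\<^esub> x = \<zero>\<^bsub>transport e N\<^esub>"
      using N.M.a_inv_closed[OF y(1)] by (auto simp: s)
  qed (auto simp: s N.M.a_ac)
  then show ?thesis
    by (intro right_module.intro right_module_axioms.intro N.R.ring_axioms)
      (auto simp: s N.smult_closed N.smult_l_distr N.smult_r_distr N.smult_assoc N.smult_one)
qed

lemma transport_hom: "inj e \<Longrightarrow> e \<in> rmod_hom R N (transport e N)"
  by (rule rmod_homI) (auto simp: transport_simps)

lemma transport_hom_inverse:
  assumes "inj e"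
  shows "the_inv e \<in> rmod_hom R (transport e N) N"
  by (rule rmod_homI) (auto simp: transport_simps assms the_inv_f_f)

lemma finitely_presented_transport:
  assumes "finitely_presented R N" "inj e"
  shows "finitely_presented R (transport e N)"
proof -
  obtain m n q p where q: "q \<in> rmod_hom R (free_rmod R m) (free_rmod R n)"
    and p: "p \<in> rmod_hom R (free_rmod R n) N" "p ` carrier (free_rmod R n) = carrier N"
      "ker_on (free_rmod R n) N p = q ` carrier (free_rmod R m)"
    using assms(1) unfolding finitely_presented_def by blast
  have "(\<lambda>x. e (p x)) ` carrier (free_rmod R n) = carrier (transport e N)"
    using p(2) by (simp add: transport_simps(1) image_image[symmetric])
  moreover have "ker_on (free_rmod R n) (transport e N) (\<lambda>x. e (p x)) = q ` carrier (free_rmod R m)"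
    using p(3) assms(2) by (simp add: ker_on_def transport_simps(2) inj_eq)
  ultimately show ?thesis
    using q rmod_hom_comp[OF p(1) transport_hom[OF assms(2)]] assms right_module_transport
    unfolding finitely_presented_def by metis
qed

section \<open>The functor Hom(T, \<open>_\<close>)\<close>

lemma Hom_module_simps [simp]:
  "carrier (Hom_module C T X) = Hom C T X" "\<zero>\<^bsub>Hom_module C T X\<^esub> = Zer C T X"
  "f \<oplus>\<^bsub>Hom_module C T X\<^esub> g = Add C f g" "c \<odot>\<^bsub>Hom_module C T X\<^esub> f = f \<cdot>\<^bsub>C\<^esub> c"
  by (simp_all add: Hom_module_def)

lemma End_ring_simps [simp]:
  "carrier (End_ring C T) = Hom C T T" "\<zero>\<^bsub>End_ring C T\<^esub> = Zer C T T" "\<one>\<^bsub>End_ring C T\<^esub> = Id C T"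
  "f \<oplus>\<^bsub>End_ring C T\<^esub> g = Add C f g" "f \<otimes>\<^bsub>End_ring C T\<^esub> g = f \<cdot>\<^bsub>C\<^esub> g"
  by (simp_all add: End_ring_def)

context maximal_orthogonal
begin

abbreviation "R \<equiv> End_ring C T"
abbreviation "F X \<equiv> Hom_module C T X"

lemma right_module_F: "X \<in> Ob C \<Longrightarrow> right_module R (F X)"
  using right_module_Hom_module T_Ob by blast

lemma comp_hom:
  assumes "u \<in> Hom C X Y"
  shows "(\<lambda>t. u \<cdot> t) \<in> rmod_hom R (F X) (F Y)"
  by (rule rmod_homI) (auto simp: Comp_in[OF _ assms] Comp_Add[OF _ _ assms] Comp_assoc[OF _ _ assms])

text \<open>A Yoneda argument: on a copy of \<open>T\<close> a module map is composition with its
  value at the inclusion, here \<open>D i2\<close>, because it respects the right action.\<close>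

lemma F_full:
  assumes X: "X \<in> add_obj C T" and "Y \<in> Ob C" "D \<in> rmod_hom R (F X) (F Y)"
  shows "\<exists>u \<in> Hom C X Y. \<forall>t \<in> Hom C T X. D t = u \<cdot> t"
  using X assms(3)
proof (induction arbitrary: D rule: add_obj_induct)
  case (zero Z)
  have oZ: "Z \<in> Ob C" using zero(1) by (simp add: zero_object_def)
  have "D t = Zer C Z Y \<cdot> t" if t: "t \<in> Hom C T Z" for t
    using zero_object_Cod[OF zero(1) t] Zer_Comp[OF t assms(2)]
      rmod_hom_zero[OF right_module_F[OF oZ] right_module_F[OF assms(2)] zero(2)] by simp
  then show ?case using Zer_in[OF oZ assms(2)] by blast
next
  case (sum Z W i1 i2 p1 p2)
  have h: "i1 \<in> Hom C W Z" "i2 \<in> Hom C T Z" "p1 \<in> Hom C Z W" "p2 \<in> Hom C Z T"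
    using sum(2) unfolding biproduct_def by blast+
  obtain v where v: "v \<in> Hom C W Y" "\<forall>t \<in> Hom C T W. D (i1 \<cdot> t) = v \<cdot> t"
    using sum(1)[OF rmod_hom_comp[OF comp_hom[OF h(1)] sum(3)]] by blast
  have d: "D i2 \<in> Hom C T Y" using rmod_homD(1)[OF sum(3), of i2] h(2) by simp
  note vp = Comp_in[OF h(3) v(1)] and dp = Comp_in[OF h(4) d]
  have "D t = Add C (v \<cdot> p1) (D i2 \<cdot> p2) \<cdot> t" if t: "t \<in> Hom C T Z" for t
  proof -
    note t1 = Comp_in[OF t h(3)] and t2 = Comp_in[OF t h(4)]
    have "D t = Add C (D (i1 \<cdot> (p1 \<cdot> t))) (D (i2 \<cdot> (p2 \<cdot> t)))"
      using rmod_homD(2)[OF sum(3), of "i1 \<cdot> (p1 \<cdot> t)" "i2 \<cdot> (p2 \<cdot> t)"] Comp_in[OF t1 h(1)]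
        Comp_in[OF t2 h(2)] biproduct_decompose(1)[OF sum(2) t] by simp
    also have "D (i1 \<cdot> (p1 \<cdot> t)) = (v \<cdot> p1) \<cdot> t" using v(2) t1 Comp_assoc[OF t h(3) v(1)] by simp
    also have "D (i2 \<cdot> (p2 \<cdot> t)) = (D i2 \<cdot> p2) \<cdot> t"
      using rmod_homD(3)[OF sum(3), of "p2 \<cdot> t" i2] t2 h(2) Comp_assoc[OF t h(4) d] by simp
    finally show ?thesis using Add_Comp[OF t vp dp] by simp
  qed
  then show ?case using Add_in[OF vp dp] by blast
next
  case (retract X Z i p)
  obtain v where v: "v \<in> Hom C Z Y" "\<forall>t \<in> Hom C T Z. D (p \<cdot> t) = v \<cdot> t"
    using retract(1)[OF rmod_hom_comp[OF comp_hom[OF retract(3)] retract(5)]] by blast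
  have "D t = (v \<cdot> i) \<cdot> t" if t: "t \<in> Hom C T X" for t
    using v(2)[rule_format, OF Comp_in[OF t retract(2)]] Comp_assoc[OF t retract(2,3)] retract(4)
      Id_Comp[OF t] Comp_assoc[OF t retract(2) v(1)] by simp
  then show ?case using Comp_in[OF retract(2) v(1)] by blast
qed

text \<open>On each copy of \<open>T\<close> the image of the inclusion \<open>i2\<close> is lifted
  to some \<open>a\<close>, and the lift is extended by the action on \<open>a\<close>. The carrier
  types stay arbitrary, so the result applies before any encoding.\<close>

lemma F_lift:
  assumes X: "X \<in> add_obj C T" and A: "right_module R A" and B: "right_module R B"
    and e: "e \<in> rmod_hom R A B" "e ` carrier A = carrier B" and f: "f \<in> rmod_hom R (F X) B"
  shows "\<exists>g \<in> rmod_hom R (F X) A. \<forall>t \<in> Hom C T X. e (g t) = f t"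
  using X f
proof (induction arbitrary: f rule: add_obj_induct)
  case (zero Z)
  have oZ: "Z \<in> Ob C" using zero(1) by (simp add: zero_object_def)
  have "e \<zero>\<^bsub>A\<^esub> = f t" if t: "t \<in> Hom C T Z" for t
    using zero_object_Cod[OF zero(1) t] rmod_hom_zero[OF right_module_F[OF oZ] B zero(2)]
      rmod_hom_zero[OF A B e(1)] by simp
  then show ?case by (intro bexI[OF _ rmod_hom_const_zero[OF A]]) simp
next
  case (sum Z W i1 i2 p1 p2)
  interpret A: right_module R A by fact
  have h: "i1 \<in> Hom C W Z" "i2 \<in> Hom C T Z" "p1 \<in> Hom C Z W" "p2 \<in> Hom C Z T"
    using sum(2) unfolding biproduct_def by blast+
  note f = sum(3)
  obtain g1 where g1: "g1 \<in> rmod_hom R (F W) A" "\<forall>t \<in> Hom C T W. e (g1 t) = f (i1 \<cdot> t)"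
    using sum(1)[OF rmod_hom_comp[OF comp_hom[OF h(1)] f]] by blast
  have "f i2 \<in> e ` carrier A" using rmod_homD(1)[OF f, of i2] h(2) e(2) by simp
  then obtain a where a: "a \<in> carrier A" "e a = f i2" by auto
  have "(\<lambda>r. r \<odot>\<^bsub>A\<^esub> a) \<in> rmod_hom R (F T) A"
  proof (rule rmod_homI)
    fix r s assume "r \<in> carrier (F T)" "s \<in> carrier (F T)"
    then show "(r \<oplus>\<^bsub>F T\<^esub> s) \<odot>\<^bsub>A\<^esub> a = r \<odot>\<^bsub>A\<^esub> a \<oplus>\<^bsub>A\<^esub> s \<odot>\<^bsub>A\<^esub> a"
      using A.smult_l_distr[of r s a] a(1) by simp
  next
    fix c r assume "c \<in> carrier R" "r \<in> carrier (F T)"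
    then show "(c \<odot>\<^bsub>F T\<^esub> r) \<odot>\<^bsub>A\<^esub> a = c \<odot>\<^bsub>A\<^esub> (r \<odot>\<^bsub>A\<^esub> a)"
      using A.smult_assoc[of r c a] a(1) by simp
  qed (use A.smult_closed a(1) in simp)
  note g2 = rmod_hom_comp[OF comp_hom[OF h(4)] this]
  note g = rmod_hom_add[OF A rmod_hom_comp[OF comp_hom[OF h(3)] g1(1)] g2]
  have "e (g1 (p1 \<cdot> t) \<oplus>\<^bsub>A\<^esub> (p2 \<cdot> t) \<odot>\<^bsub>A\<^esub> a) = f t" if t: "t \<in> Hom C T Z" for t
  proof -
    note t1 = Comp_in[OF t h(3)] and t2 = Comp_in[OF t h(4)]
    have "e (g1 (p1 \<cdot> t) \<oplus>\<^bsub>A\<^esub> (p2 \<cdot> t) \<odot>\<^bsub>A\<^esub> a) = e (g1 (p1 \<cdot> t)) \<oplus>\<^bsub>B\<^esub> e ((p2 \<cdot> t) \<odot>\<^bsub>A\<^esub> a)"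
      using rmod_homD(2)[OF e(1)] rmod_homD(1)[OF g1(1)] A.smult_closed a(1) t1 t2 by simp
    also have "e (g1 (p1 \<cdot> t)) = f (i1 \<cdot> (p1 \<cdot> t))" using g1(2) t1 by simp
    also have "e ((p2 \<cdot> t) \<odot>\<^bsub>A\<^esub> a) = f (i2 \<cdot> (p2 \<cdot> t))"
      using rmod_homD(3)[OF e(1), of "p2 \<cdot> t" a] rmod_homD(3)[OF f, of "p2 \<cdot> t" i2] a t2 h(2) by simp
    also have "f (i1 \<cdot> (p1 \<cdot> t)) \<oplus>\<^bsub>B\<^esub> f (i2 \<cdot> (p2 \<cdot> t)) = f t"
      using rmod_homD(2)[OF f, of "i1 \<cdot> (p1 \<cdot> t)" "i2 \<cdot> (p2 \<cdot> t)"] Comp_in[OF t1 h(1)]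
        Comp_in[OF t2 h(2)] biproduct_decompose(1)[OF sum(2) t] by simp
    finally show ?thesis .
  qed
  then show ?case by (intro bexI[OF _ g]) simp
next
  case (retract X Z i p)
  obtain g where g: "g \<in> rmod_hom R (F Z) A" "\<forall>t \<in> Hom C T Z. e (g t) = f (p \<cdot> t)"
    using retract(1)[OF rmod_hom_comp[OF comp_hom[OF retract(3)] retract(5)]] by blast
  have "e (g (i \<cdot> t)) = f t" if t: "t \<in> Hom C T X" for t
    using g(2)[rule_format, OF Comp_in[OF t retract(2)]] Comp_assoc[OF t retract(2,3)] retract(4)
      Id_Comp[OF t] by simp
  then show ?case by (intro bexI[OF _ rmod_hom_comp[OF comp_hom[OF retract(2)] g(1)]]) simp
qed

section \<open>Free modules and finite presentations\<close>

definition product_projections :: "nat \<Rightarrow> 'o \<Rightarrow> (nat \<Rightarrow> 'a) \<Rightarrow> bool"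
  where "product_projections n Z p \<longleftrightarrow> (\<forall>j < n. p j \<in> Hom C Z T) \<and>
    (\<forall>r. (\<forall>j < n. r j \<in> Hom C T T) \<longrightarrow> (\<exists>z \<in> Hom C T Z. \<forall>j < n. p j \<cdot> z = r j)) \<and>
    (\<forall>z \<in> Hom C T Z. \<forall>z' \<in> Hom C T Z. (\<forall>j < n. p j \<cdot> z = p j \<cdot> z') \<longrightarrow> z = z')"

lemma product_projectionsD:
  assumes "product_projections n Z p"
  shows "j < n \<Longrightarrow> p j \<in> Hom C Z T"
    and "(\<And>j. j < n \<Longrightarrow> r j \<in> Hom C T T) \<Longrightarrow> \<exists>z \<in> Hom C T Z. \<forall>j < n. p j \<cdot> z = r j"
    and "z \<in> Hom C T Z \<Longrightarrow> z' \<in> Hom C T Z \<Longrightarrow> (\<And>j. j < n \<Longrightarrow> p j \<cdot> z = p j \<cdot> z') \<Longrightarrow> z = z'"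
  using assms unfolding product_projections_def by simp_all

lemma copies_projections:
  assumes "copies C T n Z"
  shows "\<exists>p. product_projections n Z p"
  using assms
proof (induction n arbitrary: Z)
  case 0
  then have z: "zero_object C Z" and o: "Z \<in> Ob C" by (simp_all add: zero_object_def)
  have "z' = z''" if "z' \<in> Hom C T Z" "z'' \<in> Hom C T Z" for z' z''
    using zero_object_Cod[OF z that(1)] zero_object_Cod[OF z that(2)] by simp
  then show ?case using Zer_in[OF T_Ob o] unfolding product_projections_def by blast
next
  case (Suc n)
  obtain W i1 i2 p1 p2 where W: "copies C T n W" and b: "biproduct Z W T i1 i2 p1 p2"
    using Suc(2) unfolding copies.simps direct_sum_iff by blast
  have h: "i1 \<in> Hom C W Z" "i2 \<in> Hom C T Z" "p1 \<in> Hom C Z W" "p2 \<in> Hom C Z T"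
    and pi: "p1 \<cdot> i1 = Id C W" "p2 \<cdot> i2 = Id C T" "p1 \<cdot> i2 = Zer C T W" "p2 \<cdot> i1 = Zer C W T"
    using b unfolding biproduct_def by blast+
  obtain p where "product_projections n W p" using Suc(1)[OF W] by blast
  note p = product_projectionsD[OF this]
  \<comment> \<open>The copy of \<open>T\<close> added last receives the index
    \<open>n\<close>.\<close>
  define q where "q j = (if j < n then p j \<cdot> p1 else p2)" for j
  have qz: "q j \<cdot> z = (if j < n then p j \<cdot> (p1 \<cdot> z) else p2 \<cdot> z)" if "z \<in> Hom C T Z" for j z
    unfolding q_def using Comp_assoc[OF that h(3) p(1)] by simp
  have "product_projections (Suc n) Z q"
    unfolding product_projections_def
  proof (intro conjI allI impI ballI)
    fix j show "q j \<in> Hom C Z T" unfolding q_def using h(4) Comp_in[OF h(3) p(1)] by simp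
  next
    fix r assume r: "\<forall>j < Suc n. r j \<in> Hom C T T"
    then obtain w where w: "w \<in> Hom C T W" "\<forall>j < n. p j \<cdot> w = r j" using p(2)[of r] by auto
    have rn: "r n \<in> Hom C T T" using r by simp
    note iw = Comp_in[OF w(1) h(1)] and ir = Comp_in[OF rn h(2)]
    let ?z = "Add C (i1 \<cdot> w) (i2 \<cdot> r n)"
    have z: "?z \<in> Hom C T Z" using Add_in[OF iw ir] .
    have "p1 \<cdot> ?z = w"
      using Comp_Add[OF iw ir h(3)] Comp_assoc[OF w(1) h(1,3)] Comp_assoc[OF rn h(2,3)] pi
        Id_Comp[OF w(1)] Zer_Comp[OF rn, of W] Hom_Ob[OF w(1)] Add_Zer[OF w(1)] by simp
    moreover have "p2 \<cdot> ?z = r n"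
      using Comp_Add[OF iw ir h(4)] Comp_assoc[OF w(1) h(1,4)] Comp_assoc[OF rn h(2,4)] pi
        Id_Comp[OF rn] Zer_Comp[OF w(1) T_Ob] Zer_Add[OF rn] by simp
    ultimately have "\<forall>j < Suc n. q j \<cdot> ?z = r j" using qz[OF z] w(2) by (auto simp: less_Suc_eq)
    then show "\<exists>z \<in> Hom C T Z. \<forall>j < Suc n. q j \<cdot> z = r j" using z by blast
  next
    fix z z' assume z: "z \<in> Hom C T Z" "z' \<in> Hom C T Z" and eq: "\<forall>j < Suc n. q j \<cdot> z = q j \<cdot> z'"
    have 2: "p2 \<cdot> z = p2 \<cdot> z'" using eq[rule_format, of n] qz z by simp
    have 1: "p1 \<cdot> z = p1 \<cdot> z'"
    proof (rule p(3)[OF Comp_in[OF z(1) h(3)] Comp_in[OF z(2) h(3)]])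
      fix j assume "j < n"
      then show "p j \<cdot> (p1 \<cdot> z) = p j \<cdot> (p1 \<cdot> z')" using eq[rule_format, of j] qz z by simp
    qed
    show "z = z'"
      using biproduct_decompose(1)[OF b z(1)] unfolding 1 2 biproduct_decompose(1)[OF b z(2)] ..
  qed
  then show ?case by blast
qed

lemma F_copies_free:
  assumes "copies C T n Z"
  obtains \<kappa> where "\<kappa> \<in> rmod_hom R (F Z) (free_rmod R n)"
    "bij_betw \<kappa> (Hom C T Z) (carrier (free_rmod R n))"
proof -
  obtain p where "product_projections n Z p" using copies_projections[OF assms] by blast
  note p = product_projectionsD[OF this]
  define \<kappa> where "\<kappa> z = (\<lambda>j \<in> {..<n}. p j \<cdot> z)" for z
  have cl: "\<kappa> z \<in> {..<n} \<rightarrow>\<^sub>E Hom C T T" if "z \<in> Hom C T Z" for z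
    unfolding \<kappa>_def using Comp_in[OF that p(1)] by auto
  have "\<kappa> \<in> rmod_hom R (F Z) (free_rmod R n)"
  proof (rule rmod_homI)
    fix x y assume xy: "x \<in> carrier (F Z)" "y \<in> carrier (F Z)"
    show "\<kappa> (x \<oplus>\<^bsub>F Z\<^esub> y) = \<kappa> x \<oplus>\<^bsub>free_rmod R n\<^esub> \<kappa> y"
      using xy by (auto simp: \<kappa>_def free_rmod_def Comp_Add[OF _ _ p(1)] intro!: restrict_ext)
  next
    fix r x assume "r \<in> carrier R" "x \<in> carrier (F Z)"
    then show "\<kappa> (r \<odot>\<^bsub>F Z\<^esub> x) = r \<odot>\<^bsub>free_rmod R n\<^esub> \<kappa> x"
      by (auto simp: \<kappa>_def free_rmod_def Comp_assoc[OF _ _ p(1)] intro!: restrict_ext)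
  qed (use cl in \<open>simp add: free_rmod_def\<close>)
  moreover have "bij_betw \<kappa> (Hom C T Z) (carrier (free_rmod R n))"
    unfolding bij_betw_def
  proof (intro conjI subset_antisym subsetI)
    show "inj_on \<kappa> (Hom C T Z)"
    proof (rule inj_onI)
      fix x y assume xy: "x \<in> Hom C T Z" "y \<in> Hom C T Z" "\<kappa> x = \<kappa> y"
      have "p j \<cdot> x = p j \<cdot> y" if "j < n" for j
        using fun_cong[OF xy(3), of j] that by (simp add: \<kappa>_def)
      then show "x = y" using p(3) xy(1,2) by blast
    qed
  next
    fix r assume "r \<in> carrier (free_rmod R n)"
    then have r: "r \<in> {..<n} \<rightarrow>\<^sub>E Hom C T T" by (simp add: free_rmod_def)
    then have "r j \<in> Hom C T T" if "j < n" for j using that by (auto simp: PiE_iff)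
    then obtain z where z: "z \<in> Hom C T Z" "\<forall>j < n. p j \<cdot> z = r j" using p(2)[of r] by blast
    have "\<kappa> z = r"
      using z(2) r by (auto simp: \<kappa>_def fun_eq_iff restrict_def PiE_iff extensional_def)
    then show "r \<in> \<kappa> ` Hom C T Z" using z(1) by blast
  qed (use cl in \<open>auto simp: free_rmod_def\<close>)
  ultimately show ?thesis using that by blast
qed

text \<open>A summand of a free module is its quotient by the complementary summand, so the
  idempotent \<open>1 - i p\<close> supplies the relations and both ranks equal
  \<open>n\<close>.\<close>

lemma finitely_presented_F:
  assumes X: "X \<in> add_obj C T"
  shows "finitely_presented R (F X)"
proof -
  obtain n Z i p where Z: "copies C T n Z" and i: "i \<in> Hom C X Z" and p: "p \<in> Hom C Z X"
    and pi: "p \<cdot> i = Id C X"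
    using X by (rule add_objE)
  have o: "X \<in> Ob C" "Z \<in> Ob C" using i Hom_Ob by blast+
  obtain \<kappa> where \<kappa>: "\<kappa> \<in> rmod_hom R (F Z) (free_rmod R n)"
    "bij_betw \<kappa> (carrier (F Z)) (carrier (free_rmod R n))" using F_copies_free[OF Z] by auto
  define \<kappa>' where "\<kappa>' = inv_into (carrier (F Z)) \<kappa>"
  have \<kappa>': "\<kappa>' \<in> rmod_hom R (free_rmod R n) (F Z)"
    unfolding \<kappa>'_def using rmod_hom_inverse[OF right_module_F[OF o(2)] \<kappa>] .
  have \<kappa>'_in: "\<kappa>' r \<in> Hom C T Z" if "r \<in> carrier (free_rmod R n)" for r
    using rmod_homD(1)[OF \<kappa>' that] by simp
  have \<kappa>_in: "\<kappa> z \<in> carrier (free_rmod R n)" if "z \<in> Hom C T Z" for z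
    using rmod_homD(1)[OF \<kappa>(1)] that by simp
  have \<kappa>\<kappa>': "\<kappa> (\<kappa>' r) = r" if "r \<in> carrier (free_rmod R n)" for r
    unfolding \<kappa>'_def using bij_betw_inv_into_right[OF \<kappa>(2) that] .
  have \<kappa>'\<kappa>: "\<kappa>' (\<kappa> z) = z" if "z \<in> Hom C T Z" for z
    unfolding \<kappa>'_def using bij_betw_inv_into_left[OF \<kappa>(2)] that by simp
  define e where "e = Sub (Id C Z) (i \<cdot> p)"
  note ip = Comp_in[OF p i] and iZ = Id_in[OF o(2)]
  have e: "e \<in> Hom C Z Z" unfolding e_def using Sub_in[OF iZ ip] .
  have pe: "p \<cdot> e = Zer C Z X"
    unfolding e_def using Comp_Sub[OF iZ ip p] Comp_Id[OF p] Comp_assoc[OF p i p] pi Id_Comp[OF p]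
      Sub_self[OF p] by simp
  have ez: "e \<cdot> z = z" if z: "z \<in> Hom C T Z" and pz: "p \<cdot> z = Zer C T X" for z
    unfolding e_def using Sub_Comp[OF z iZ ip] Id_Comp[OF z] Comp_assoc[OF z p i] pz
      Comp_Zer[OF i T_Ob] Sub_Zer[OF z] by simp
  let ?q = "\<lambda>r. \<kappa> (e \<cdot> \<kappa>' r)" and ?p = "\<lambda>r. p \<cdot> \<kappa>' r"
  have "?q \<in> rmod_hom R (free_rmod R n) (free_rmod R n)"
    using rmod_hom_comp[OF rmod_hom_comp[OF \<kappa>' comp_hom[OF e]] \<kappa>(1)] .
  moreover have "?p \<in> rmod_hom R (free_rmod R n) (F X)"
    using rmod_hom_comp[OF \<kappa>' comp_hom[OF p]] .
  moreover have "?p ` carrier (free_rmod R n) = carrier (F X)"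
  proof (intro subset_antisym subsetI)
    fix x assume x: "x \<in> carrier (F X)"
    then have "i \<cdot> x \<in> Hom C T Z" "x = p \<cdot> (i \<cdot> x)"
      using Comp_in[OF _ i] Comp_assoc[OF _ i p] pi Id_Comp by simp_all
    then have "x = ?p (\<kappa> (i \<cdot> x))" "\<kappa> (i \<cdot> x) \<in> carrier (free_rmod R n)"
      using \<kappa>'\<kappa> \<kappa>_in by simp_all
    then show "x \<in> ?p ` carrier (free_rmod R n)" by blast
  qed (use Comp_in[OF \<kappa>'_in p] in auto)
  moreover have "ker_on (free_rmod R n) (F X) ?p = ?q ` carrier (free_rmod R n)"
  proof (intro subset_antisym subsetI)
    fix r assume "r \<in> ker_on (free_rmod R n) (F X) ?p"
    then have r: "r \<in> carrier (free_rmod R n)" "p \<cdot> \<kappa>' r = Zer C T X" by (auto simp: ker_on_def)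
    then have "r = ?q r" using ez[OF \<kappa>'_in] \<kappa>\<kappa>' by simp
    then show "r \<in> ?q ` carrier (free_rmod R n)" using r(1) by blast
  next
    fix r assume "r \<in> ?q ` carrier (free_rmod R n)"
    then obtain r' where r': "r' \<in> carrier (free_rmod R n)" "r = ?q r'" by blast
    note z = \<kappa>'_in[OF r'(1)]
    have "?p r = Zer C T X"
      using r'(2) \<kappa>'\<kappa>[OF Comp_in[OF z e]] Comp_assoc[OF z e p] pe Zer_Comp[OF z o(1)] by simp
    then show "r \<in> ker_on (free_rmod R n) (F X) ?p"
      using r'(2) \<kappa>_in[OF Comp_in[OF z e]] by (simp add: ker_on_def)
  qed
  ultimately show ?thesis using right_module_F[OF o(1)] unfolding finitely_presented_def by blast
qed

end

section \<open>Projective resolutions\<close>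

text \<open>The length of any resolution bounds the infimum by a finite value.\<close>

lemma proj_dim_eq_infinity_iff:
  "proj_dim R N = \<infinity> \<longleftrightarrow> \<not> (\<exists>n P d \<epsilon>. proj_resolution R N n P d \<epsilon>)"
proof (cases "\<exists>n P d \<epsilon>. proj_resolution R N n P d \<epsilon>")
  case True
  then obtain n where "n \<in> {n. \<exists>P d \<epsilon>. proj_resolution R N n P d \<epsilon>}" by blast
  then have "proj_dim R N \<le> enat n" unfolding proj_dim_def by (rule INF_lower)
  then have "proj_dim R N \<noteq> \<infinity>" by (metis infinity_ileE)
  with True show ?thesis by blast
next
  case False
  then have "{n. \<exists>P d \<epsilon>. proj_resolution R N n P d \<epsilon>} = {}" by blast
  then have "proj_dim R N = \<infinity>" by (simp add: proj_dim_def top_enat_def)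
  with False show ?thesis by blast
qed

definition encode :: "'a \<Rightarrow> (nat \<Rightarrow> 'a) set"
  where "encode f = {\<lambda>_. f}"

lemma inj_encode: "inj encode"
  by (rule injI) (simp add: encode_def fun_eq_iff)

context maximal_orthogonal
begin

text \<open>A copy of \<open>Hom(T, X)\<close> whose carrier has the type required by \<open>mod_fp\<close>, with singletons as elements.\<close>

definition FF :: "'o \<Rightarrow> ('a, (nat \<Rightarrow> 'a) set) module"
  where "FF X = transport encode (F X)"

lemma FF_carrier: "carrier (FF X) = encode ` Hom C T X"
  and FF_zero: "\<zero>\<^bsub>FF X\<^esub> = encode (Zer C T X)"
  by (simp_all add: FF_def transport_simps)

lemma encode_hom: "encode \<in> rmod_hom R (F X) (FF X)"
  unfolding FF_def by (rule transport_hom[OF inj_encode])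

lemma decode_hom: "the_inv encode \<in> rmod_hom R (FF X) (F X)"
  unfolding FF_def by (rule transport_hom_inverse[OF inj_encode])

lemma decode_encode: "the_inv encode (encode f) = f"
  by (rule the_inv_f_f[OF inj_encode])

lemma FF_mod_fp: "X \<in> add_obj C T \<Longrightarrow> FF X \<in> mod_fp R"
  unfolding mod_fp_def FF_def using finitely_presented_transport[OF finitely_presented_F inj_encode] by simp

lemma mod_fp_right_module: "N \<in> mod_fp R \<Longrightarrow> right_module R N"
  by (simp add: mod_fp_def finitely_presented_def)

lemma FF_projective:
  assumes X: "X \<in> add_obj C T"
  shows "projective_in_mod R (FF X)"
  unfolding projective_in_mod_def
proof (intro conjI ballI impI)
  show "FF X \<in> mod_fp R" using FF_mod_fp[OF X] .
  fix A B e f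
  assume A: "A \<in> mod_fp R" and B: "B \<in> mod_fp R" and e: "e \<in> rmod_hom R A B"
    and f: "f \<in> rmod_hom R (FF X) B" and s: "e ` carrier A = carrier B"
  obtain g where g: "g \<in> rmod_hom R (F X) A" "\<forall>t \<in> Hom C T X. e (g t) = f (encode t)"
    using F_lift[OF X mod_fp_right_module[OF A] mod_fp_right_module[OF B] e s
        rmod_hom_comp[OF encode_hom f]] by blast
  show "\<exists>g \<in> rmod_hom R (FF X) A. \<forall>x \<in> carrier (FF X). e (g x) = f x"
    by (rule bexI[OF _ rmod_hom_comp[OF decode_hom g(1)]])
      (use g(2) in \<open>auto simp: FF_carrier decode_encode\<close>)
qed

text \<open>A summand of \<open>R\<^sup>n\<close> is \<open>Hom(T, _)\<close> of the object that splits the corresponding idempotent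
  of \<open>T\<^sup>n\<close>.\<close>

lemma projective_is_F:
  assumes split: "idempotents_split_on C (add_obj C T)" and P: "projective_in_mod R P"
  shows "\<exists>X \<theta>. X \<in> add_obj C T \<and> \<theta> \<in> rmod_hom R (F X) P \<and> bij_betw \<theta> (Hom C T X) (carrier P)"
proof -
  have Pfp: "P \<in> mod_fp R" using P unfolding projective_in_mod_def by blast
  then obtain n p where p: "p \<in> rmod_hom R (free_rmod R n) P" "p ` carrier (free_rmod R n) = carrier P"
    unfolding mod_fp_def finitely_presented_def by blast
  obtain Z where cZ: "copies C T n Z" using ex_copies[OF T_Ob] by blast
  have Z: "Z \<in> add_obj C T" using copies_in_add_obj[OF T_Ob cZ] .
  obtain \<kappa> where \<kappa>: "\<kappa> \<in> rmod_hom R (F Z) (free_rmod R n)"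
    "bij_betw \<kappa> (Hom C T Z) (carrier (free_rmod R n))" using F_copies_free[OF cZ] .
  define E where "E = (\<lambda>z. p (\<kappa> z))"
  have E: "E \<in> rmod_hom R (F Z) P" unfolding E_def using rmod_hom_comp[OF \<kappa>(1) p(1)] .
  have Es: "E ` Hom C T Z = carrier P"
    using p(2) bij_betw_imp_surj_on[OF \<kappa>(2)] by (simp add: E_def image_image[symmetric])
  \<comment> \<open>Projectivity speaks only of modules in \<open>mod_fp\<close>, so the identity of
    \<open>P\<close> is lifted to the encoded \<open>FF Z\<close> and decoded afterwards.\<close>
  have "(\<lambda>x. E (the_inv encode x)) ` carrier (FF Z) = carrier P"
    using Es by (simp add: FF_carrier image_image decode_encode)
  moreover note rmod_hom_comp[OF decode_hom E] rmod_hom_id[of R P]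
  ultimately obtain g where g: "g \<in> rmod_hom R P (FF Z)" "\<forall>x \<in> carrier P. E (the_inv encode (g x)) = x"
    using P Pfp FF_mod_fp[OF Z] unfolding projective_in_mod_def by metis
  define G where "G = (\<lambda>x. the_inv encode (g x))"
  have G: "G \<in> rmod_hom R P (F Z)" unfolding G_def using rmod_hom_comp[OF g(1) decode_hom] .
  have Gin: "G x \<in> Hom C T Z" if "x \<in> carrier P" for x using rmod_homD(1)[OF G that] by simp
  have Ein: "E z \<in> carrier P" if "z \<in> Hom C T Z" for z using Es that by blast
  have EG: "E (G x) = x" if "x \<in> carrier P" for x using g(2) that by (simp add: G_def)
  \<comment> \<open>\<open>G\<close> is a section of \<open>E\<close>, so \<open>G\<close> after
    \<open>E\<close> is an idempotent; fullness realises it by an arrow of C.\<close>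
  obtain e where e: "e \<in> Hom C Z Z" and et: "\<And>t. t \<in> Hom C T Z \<Longrightarrow> G (E t) = e \<cdot> t"
    using F_full[OF Z add_obj_Ob[OF Z] rmod_hom_comp[OF E G]] by blast
  have "e \<cdot> e = e"
  proof (rule add_obj_faithful[OF Z Comp_in[OF e e] e])
    fix t assume t: "t \<in> Hom C T Z"
    show "(e \<cdot> e) \<cdot> t = e \<cdot> t"
      using Comp_assoc[OF t e e] et[OF t] et[OF Gin[OF Ein[OF t]]] EG[OF Ein[OF t]] by simp
  qed
  then obtain Y r s where r: "r \<in> Hom C Z Y" and s: "s \<in> Hom C Y Z"
    and rs: "r \<cdot> s = Id C Y" and sr: "s \<cdot> r = e"
    using split Z e unfolding idempotents_split_on_def by blast
  have es: "e \<cdot> s = s" using sr Comp_assoc[OF s r s] rs Comp_Id[OF s] by simp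
  have GEs: "G (E (s \<cdot> y)) = s \<cdot> y" if y: "y \<in> Hom C T Y" for y
    using et[OF Comp_in[OF y s]] Comp_assoc[OF y s e] es by simp
  have rsy: "r \<cdot> (s \<cdot> y) = y" if y: "y \<in> Hom C T Y" for y
    using Comp_assoc[OF y s r] rs Id_Comp[OF y] by simp
  have "bij_betw (\<lambda>y. E (s \<cdot> y)) (Hom C T Y) (carrier P)"
  proof (rule bij_betw_byWitness[where f' = "\<lambda>x. r \<cdot> G x"])
    show "\<forall>y \<in> Hom C T Y. r \<cdot> G (E (s \<cdot> y)) = y" using GEs rsy by simp
    show "\<forall>x \<in> carrier P. E (s \<cdot> (r \<cdot> G x)) = x"
    proof
      fix x assume x: "x \<in> carrier P"
      show "E (s \<cdot> (r \<cdot> G x)) = x"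
        using Comp_assoc[OF Gin[OF x] r s] sr et[OF Gin[OF x]] EG[OF x] by simp
    qed
    show "(\<lambda>y. E (s \<cdot> y)) ` Hom C T Y \<subseteq> carrier P" using Ein Comp_in[OF _ s] by blast
    show "(\<lambda>x. r \<cdot> G x) ` carrier P \<subseteq> Hom C T Y" using Gin Comp_in[OF _ r] by blast
  qed
  then show ?thesis using retract_in_add_obj[OF Z s r rs] rmod_hom_comp[OF comp_hom[OF s] E] by blast
qed

section \<open>Lifting module resolutions to complexes in add T\<close>

lemma T_exact_if_module_exact:
  assumes X: "X \<in> add_obj C T" and f: "f \<in> Hom C X Y" and g: "g \<in> Hom C Y Z"
    and N: "right_module R N"
    and \<theta>1: "bij_betw \<theta>1 (Hom C T X) (carrier L)"
    and \<theta>2: "bij_betw \<theta>2 (Hom C T Y) (carrier M)"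
    and \<theta>3: "\<theta>3 \<in> rmod_hom R (F Z) N" "bij_betw \<theta>3 (Hom C T Z) (carrier N)"
    and ker: "ker_on M N d2 = d1 ` carrier L"
    and c1: "\<And>t. t \<in> Hom C T X \<Longrightarrow> \<theta>2 (f \<cdot> t) = d1 (\<theta>1 t)"
    and c2: "\<And>t. t \<in> Hom C T Y \<Longrightarrow> \<theta>3 (g \<cdot> t) = d2 (\<theta>2 t)"
  shows "T_exact X Y Z f g"
proof -
  have o: "X \<in> Ob C" "Z \<in> Ob C" using f g Hom_Ob by blast+
  have z3: "\<theta>3 (Zer C T Z) = \<zero>\<^bsub>N\<^esub>" using rmod_hom_zero[OF right_module_F[OF o(2)] N \<theta>3(1)] by simp
  have dd: "d2 (d1 x) = \<zero>\<^bsub>N\<^esub>" if "x \<in> carrier L" for x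
    using ker that unfolding ker_on_def by blast
  have "g \<cdot> f = Zer C X Z"
  proof (rule add_obj_faithful[OF X Comp_in[OF f g] Zer_in[OF o]])
    fix t assume t: "t \<in> Hom C T X"
    note ft = Comp_in[OF t f]
    have "\<theta>3 (g \<cdot> (f \<cdot> t)) = \<theta>3 (Zer C T Z)"
      using c2[OF ft] c1[OF t] dd[OF bij_betw_apply[OF \<theta>1 t]] z3 by simp
    then have "g \<cdot> (f \<cdot> t) = Zer C T Z"
      using inj_onD[OF bij_betw_imp_inj_on[OF \<theta>3(2)]] Comp_in[OF ft g] Zer_in[OF T_Ob o(2)] by blast
    then show "(g \<cdot> f) \<cdot> t = Zer C X Z \<cdot> t" using Comp_assoc[OF t f g] Zer_Comp[OF t o(2)] by simp
  qed
  moreover have "\<exists>s \<in> Hom C T X. t = f \<cdot> s" if t: "t \<in> Hom C T Y" and gt: "g \<cdot> t = Zer C T Z" for t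
  proof -
    have "\<theta>2 t \<in> ker_on M N d2"
      using c2[OF t] gt z3 bij_betw_apply[OF \<theta>2 t] by (simp add: ker_on_def)
    then obtain x where x: "x \<in> carrier L" "\<theta>2 t = d1 x" using ker by auto
    then obtain s where s: "s \<in> Hom C T X" "x = \<theta>1 s" using bij_betw_imp_surj_on[OF \<theta>1] by auto
    have "\<theta>2 t = \<theta>2 (f \<cdot> s)" using c1[OF s(1)] x(2) s(2) by simp
    then have "t = f \<cdot> s"
      using inj_onD[OF bij_betw_imp_inj_on[OF \<theta>2]] t Comp_in[OF s(1) f] by blast
    then show ?thesis using s(1) by blast
  qed
  ultimately show ?thesis unfolding T_exact_def using f g by blast
qed

lemma F_full_conjugate:
  assumes X: "X \<in> add_obj C T" and Y: "Y \<in> Ob C"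
    and \<theta>1: "\<theta>1 \<in> rmod_hom R (F X) L" "bij_betw \<theta>1 (Hom C T X) (carrier L)"
    and \<theta>2: "\<theta>2 \<in> rmod_hom R (F Y) N" "bij_betw \<theta>2 (Hom C T Y) (carrier N)"
    and d: "d \<in> rmod_hom R L N"
  shows "\<exists>u \<in> Hom C X Y. \<forall>t \<in> Hom C T X. \<theta>2 (u \<cdot> t) = d (\<theta>1 t)"
proof -
  let ?i = "inv_into (carrier (F Y)) \<theta>2"
  have "?i \<in> rmod_hom R N (F Y)" using rmod_hom_inverse[OF right_module_F[OF Y] \<theta>2(1)] \<theta>2(2) by simp
  from F_full[OF X Y rmod_hom_comp[OF rmod_hom_comp[OF \<theta>1(1) d] this]]
  obtain u where u: "u \<in> Hom C X Y" "\<forall>t \<in> Hom C T X. ?i (d (\<theta>1 t)) = u \<cdot> t" by blast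
  have "\<theta>2 (u \<cdot> t) = d (\<theta>1 t)" if t: "t \<in> Hom C T X" for t
    using u(2) t bij_betw_inv_into_right[OF \<theta>2(2) rmod_homD(1)[OF d bij_betw_apply[OF \<theta>1(2) t]]]
    by simp
  then show ?thesis using u(1) by blast
qed

text \<open>Turns the vanishing tail of a module resolution into zero objects of C.\<close>

lemma zero_object_if_Hom_trivial:
  assumes X: "X \<in> add_obj C T" and "\<And>t. t \<in> Hom C T X \<Longrightarrow> t = Zer C T X"
  shows "zero_object C X"
proof -
  have o: "X \<in> Ob C" using add_obj_Ob[OF X] .
  have "Id C X = Zer C X X"
    using add_obj_faithful[OF X Id_in[OF o] Zer_in[OF o o]] assms(2) Id_Comp Zer_Comp[OF _ o] by metis
  then show ?thesis using o by (simp add: zero_object_def)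
qed

lemma T_mono_if_resolution:
  assumes split: "idempotents_split_on C (add_obj C T)"
    and M: "indecomposable C M" "M \<notin> add_obj C (ShO C T)"
    and res: "proj_resolution R (F M) n P d \<epsilon>"
  shows "\<exists>K T0 k a w. T0 \<in> add_obj C T \<and> dist_triangle C K T0 M k a w \<and> T_mono K T0 k"
proof -
  have oM: "M \<in> Ob C" using M(1) unfolding indecomposable_def by blast
  have P: "\<And>i. projective_in_mod R (P i)" and d: "\<And>i. d i \<in> rmod_hom R (P (Suc i)) (P i)"
    and \<epsilon>: "\<epsilon> \<in> rmod_hom R (P 0) (F M)" "\<epsilon> ` carrier (P 0) = Hom C T M"
    and ker0: "ker_on (P 0) (F M) \<epsilon> = d 0 ` carrier (P 1)"
    and ker: "\<And>i. ker_on (P (Suc i)) (P i) (d i) = d (Suc i) ` carrier (P (Suc (Suc i)))"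
    and zero: "\<And>i. i > n \<Longrightarrow> carrier (P i) = {\<zero>\<^bsub>P i\<^esub>}"
    using res unfolding proj_resolution_def by auto
  have rP: "right_module R (P i)" for i
    using P[of i] mod_fp_right_module unfolding projective_in_mod_def by blast
  \<comment> \<open>Object and isomorphism form a pair, so that a single use of
    \<open>choice\<close> selects both.\<close>
  have "\<forall>i. \<exists>X\<theta>. fst X\<theta> \<in> add_obj C T \<and> snd X\<theta> \<in> rmod_hom R (F (fst X\<theta>)) (P i) \<and>
      bij_betw (snd X\<theta>) (Hom C T (fst X\<theta>)) (carrier (P i))"
    using projective_is_F[OF split P] by simp
  then obtain X\<theta> where X\<theta>: "\<forall>i. fst (X\<theta> i) \<in> add_obj C T \<and> snd (X\<theta> i) \<in> rmod_hom R (F (fst (X\<theta> i))) (P i) \<and>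
      bij_betw (snd (X\<theta> i)) (Hom C T (fst (X\<theta> i))) (carrier (P i))"
    by (rule choice[THEN exE])
  define A where "A i = fst (X\<theta> i)" for i
  define \<theta> where "\<theta> i = snd (X\<theta> i)" for i
  have A: "A i \<in> add_obj C T" and \<theta>: "\<theta> i \<in> rmod_hom R (F (A i)) (P i)"
    and b: "bij_betw (\<theta> i) (Hom C T (A i)) (carrier (P i))" for i
    using X\<theta> unfolding A_def \<theta>_def by blast+
  have "\<forall>i. \<exists>u. u \<in> Hom C (A (Suc i)) (A i) \<and> (\<forall>t \<in> Hom C T (A (Suc i)). \<theta> i (u \<cdot> t) = d i (\<theta> (Suc i) t))"
    using F_full_conjugate[OF A add_obj_Ob[OF A] \<theta> b \<theta> b d] by blast
  then obtain u where "\<forall>i. u i \<in> Hom C (A (Suc i)) (A i) \<and>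
      (\<forall>t \<in> Hom C T (A (Suc i)). \<theta> i (u i \<cdot> t) = d i (\<theta> (Suc i) t))"
    by (rule choice[THEN exE])
  then have u: "u i \<in> Hom C (A (Suc i)) (A i)"
    and ut: "\<And>t. t \<in> Hom C T (A (Suc i)) \<Longrightarrow> \<theta> i (u i \<cdot> t) = d i (\<theta> (Suc i) t)" for i
    by blast+
  \<comment> \<open>The augmentation is lifted like a differential, with the identity as comparison
    map at \<open>M\<close>. Fullness needs only the source in add T, so \<open>M\<close> itself may
    lie outside.\<close>
  have bM: "bij_betw (\<lambda>x. x) (Hom C T M) (carrier (F M))" by (simp add: bij_betw_def)
  obtain a where a: "a \<in> Hom C (A 0) M" and at: "\<And>t. t \<in> Hom C T (A 0) \<Longrightarrow> a \<cdot> t = \<epsilon> (\<theta> 0 t)"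
    using F_full_conjugate[OF A oM \<theta> b rmod_hom_id bM \<epsilon>(1)] by blast
  have ex: "T_exact (A (Suc (Suc i))) (A (Suc i)) (A i) (u (Suc i)) (u i)" for i
    using T_exact_if_module_exact[OF A u u rP b b \<theta> b ker ut ut] .
  have "ker_on (P 0) (F M) \<epsilon> = d 0 ` carrier (P (Suc 0))" using ker0 by simp
  then have ex0: "T_exact (A (Suc 0)) (A 0) M (u 0) a"
    using T_exact_if_module_exact[OF A u a right_module_F[OF oM] b b rmod_hom_id bM _ ut at] by blast
  have epi: "T_epi (A 0) M a"
    unfolding T_epi_def
  proof (intro conjI ballI)
    fix t assume "t \<in> Hom C T M"
    then have "t \<in> \<epsilon> ` carrier (P 0)" using \<epsilon>(2) by simp
    then obtain x where x: "x \<in> carrier (P 0)" "t = \<epsilon> x" by auto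
    then have "x \<in> \<theta> 0 ` Hom C T (A 0)" using bij_betw_imp_surj_on[OF b[of 0]] by simp
    then obtain s where "s \<in> Hom C T (A 0)" "x = \<theta> 0 s" by auto
    then show "\<exists>s \<in> Hom C T (A 0). t = a \<cdot> s" using x(2) at by auto
  qed (rule a)
  have "zero_object C (A i)" if i: "i > n" for i
  proof (rule zero_object_if_Hom_trivial[OF A])
    fix t assume t: "t \<in> Hom C T (A i)"
    have z: "Zer C T (A i) \<in> Hom C T (A i)" using Zer_in[OF T_Ob add_obj_Ob[OF A]] .
    have "\<theta> i t = \<theta> i (Zer C T (A i))"
      using bij_betw_apply[OF b t] bij_betw_apply[OF b z] zero[OF i] by simp
    then show "t = Zer C T (A i)" using inj_onD[OF bij_betw_imp_inj_on[OF b] _ t z] by blast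
  qed
  then have "T_kernel_splits (A (Suc 0)) (A 0) (u 0)"
    using T_kernel_splits_finite[of A u n] A ex by simp
  moreover obtain K k w where tri: "dist_triangle C K (A 0) M k a w" using ex_dist_triangle_middle[OF a] .
  ultimately have "T_mono K (A 0) k" using T_mono_if_kernel_splits[OF split M A A epi ex0] by blast
  then show ?thesis using A tri by blast
qed

lemma resolution_if_T_mono:
  assumes T0: "T0 \<in> add_obj C T" and K: "K \<in> add_obj C T" and a: "T_epi T0 M a"
    and tri: "dist_triangle C K T0 M k a w" and k: "T_mono K T0 k"
  shows "\<exists>P d \<epsilon>. proj_resolution R (F M) 1 P d \<epsilon>"
proof -
  note th = dist_triangle_Hom[OF tri]
  have o: "K \<in> Ob C" "T0 \<in> Ob C" "M \<in> Ob C" using th Hom_Ob by blast+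
  obtain Z where Z: "zero_object C Z" using ex_zero_object by blast
  have Za: "Z \<in> add_obj C T" using zero_object_in_add_obj[OF Z] .
  \<comment> \<open>A resolution is indexed by all naturals, so the two terms are padded by a zero
    object.\<close>
  define B where "B i = (if i = 0 then T0 else if i = 1 then K else Z)" for i :: nat
  have Ba: "B i \<in> add_obj C T" for i using T0 K Za by (simp add: B_def)
  have B: "B 0 = T0" "B (Suc 0) = K" "B (Suc (Suc i)) = Z" for i by (simp_all add: B_def)
  define d where "d i = (if i = 0 then (\<lambda>x. encode (k \<cdot> the_inv encode x)) else (\<lambda>x. \<zero>\<^bsub>FF (B i)\<^esub>))" for i :: nat
  have d0: "d 0 = (\<lambda>x. encode (k \<cdot> the_inv encode x))" and dS: "d (Suc i) = (\<lambda>x. \<zero>\<^bsub>FF (B (Suc i))\<^esub>)" for i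
    by (simp_all add: d_def)
  have "Hom C T Z = {Zer C T Z}"
    using zero_object_Cod[OF Z] Zer_in[OF T_Ob add_obj_Ob[OF Za]] by blast
  then have Zc: "carrier (FF Z) = {\<zero>\<^bsub>FF Z\<^esub>}" by (simp add: FF_carrier FF_zero)
  have "proj_resolution R (F M) 1 (\<lambda>i. FF (B i)) d (\<lambda>x. a \<cdot> the_inv encode x)"
    unfolding proj_resolution_def
  proof (intro conjI allI impI)
    show "projective_in_mod R (FF (B i))" for i using FF_projective[OF Ba] .
    show "d i \<in> rmod_hom R (FF (B (Suc i))) (FF (B i))" for i
    proof (cases i)
      case 0
      then show ?thesis
        using rmod_hom_comp[OF rmod_hom_comp[OF decode_hom comp_hom[OF th(1)]] encode_hom]
        by (simp add: d0 B)
    next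
      case (Suc j)
      then show ?thesis
        using rmod_hom_const_zero[OF mod_fp_right_module[OF FF_mod_fp[OF Ba]]] by (simp add: dS)
    qed
    show "(\<lambda>x. a \<cdot> the_inv encode x) \<in> rmod_hom R (FF (B 0)) (F M)"
      using rmod_hom_comp[OF decode_hom comp_hom[OF th(2)]] by (simp add: B)
    show "(\<lambda>x. a \<cdot> the_inv encode x) ` carrier (FF (B 0)) = carrier (F M)"
      using a Comp_in[OF _ th(2)] unfolding T_epi_def
      by (auto simp: B FF_carrier image_image decode_encode)
    show "ker_on (FF (B 0)) (F M) (\<lambda>x. a \<cdot> the_inv encode x) = d 0 ` carrier (FF (B 1))"
    proof (intro subset_antisym subsetI)
      fix x assume "x \<in> ker_on (FF (B 0)) (F M) (\<lambda>x. a \<cdot> the_inv encode x)"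
      then obtain t where t: "t \<in> Hom C T T0" "x = encode t" "a \<cdot> t = Zer C T M"
        by (auto simp: ker_on_def FF_carrier B decode_encode)
      obtain s where s: "s \<in> Hom C T K" "t = k \<cdot> s" using dist_triangle_lift[OF tri t(1,3)] .
      then have "x = d 0 (encode s)" "encode s \<in> carrier (FF (B 1))"
        using t(2) by (simp_all add: d0 FF_carrier B decode_encode)
      then show "x \<in> d 0 ` carrier (FF (B 1))" by blast
    next
      fix x assume "x \<in> d 0 ` carrier (FF (B 1))"
      then obtain s where s: "s \<in> Hom C T K" "x = encode (k \<cdot> s)"
        by (auto simp: d0 FF_carrier B decode_encode)
      have "a \<cdot> (k \<cdot> s) = Zer C T M"
        using Comp_assoc[OF s(1) th(1,2)] dist_triangle_comp[OF tri] Zer_Comp[OF s(1) o(3)] by simp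
      then show "x \<in> ker_on (FF (B 0)) (F M) (\<lambda>x. a \<cdot> the_inv encode x)"
        using s(2) Comp_in[OF s(1) th(1)] by (simp add: ker_on_def FF_carrier B decode_encode)
    qed
    \<comment> \<open>At \<open>i = 0\<close> this is the injectivity given by
      \<open>T_mono\<close>; for larger \<open>i\<close> the modules in degrees \<open>Suc i\<close>
      and above are zero.\<close>
    show "ker_on (FF (B (Suc i))) (FF (B i)) (d i) = d (Suc i) ` carrier (FF (B (Suc (Suc i))))" for i
    proof (cases i)
      case 0
      have "{t \<in> Hom C T K. k \<cdot> t = Zer C T T0} = {Zer C T K}"
        using k Zer_in[OF T_Ob o(1)] Comp_Zer[OF th(1) T_Ob] unfolding T_mono_def by blast
      moreover have "ker_on (FF K) (FF T0) (d 0) = encode ` {t \<in> Hom C T K. k \<cdot> t = Zer C T T0}"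
        by (auto simp: ker_on_def FF_carrier FF_zero d0 decode_encode inj_eq[OF inj_encode])
      ultimately have "ker_on (FF K) (FF T0) (d 0) = {\<zero>\<^bsub>FF K\<^esub>}" by (simp add: FF_zero)
      then show ?thesis using 0 by (simp add: B dS Zc)
    next
      case (Suc j)
      then show ?thesis by (auto simp: B dS Zc ker_on_def)
    qed
    show "carrier (FF (B i)) = {\<zero>\<^bsub>FF (B i)\<^esub>}" if "i > 1" for i
      using that Zc by (simp add: B_def)
  qed
  then show ?thesis by blast
qed

text \<open>The zero arrow factors through \<open>M\<close>, so the ideal is never empty and equals
  the singleton as soon as all composites vanish.\<close>

lemma factorization_ideal_zero_iff:
  assumes M: "M \<in> Ob C"
  shows "factorization_ideal C T M = {Zer C (ShO C T) (ShO C T)} \<longleftrightarrow>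
    (\<forall>g \<in> Hom C (ShO C T) M. \<forall>h \<in> Hom C M (ShO C T). h \<cdot> g = Zer C (ShO C T) (ShO C T))"
proof -
  have o: "ShO C T \<in> Ob C" using ShO_in[OF T_Ob] .
  have "Zer C (ShO C T) (ShO C T) = Zer C M (ShO C T) \<cdot> Zer C (ShO C T) M"
    using Comp_Zer[OF Zer_in[OF M o] o] by simp
  then have "Zer C (ShO C T) (ShO C T) \<in> factorization_ideal C T M"
    unfolding factorization_ideal_def using Zer_in[OF o o] Zer_in[OF M o] Zer_in[OF o M] by blast
  then show ?thesis using Comp_in unfolding factorization_ideal_def by blast
qed

end

theorem theorem1p1:
  fixes C :: "('o, 'a, 'm) tri_cat_scheme" and T M :: 'o
  assumes "triangulated_category C"
    and "maximal_1_orthogonal C T"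
    and "idempotents_split_on C (add_obj C T)"
    and "indecomposable C M"
    and "M \<notin> add_obj C (ShO C T)"
  shows "proj_dim (End_ring C T) (Hom_module C T M) = \<infinity> \<longleftrightarrow>
    factorization_ideal C T M \<noteq> {Zer C (ShO C T) (ShO C T)}"
proof -
  interpret maximal_orthogonal C T
    using assms(1,2) by (simp add: maximal_orthogonal_def maximal_orthogonal_axioms_def)
  have M: "M \<in> Ob C" using assms(4) unfolding indecomposable_def by blast
  \<comment> \<open>Both sides of the claim are negated: a finite resolution exists exactly when the
    ideal is zero.\<close>
  have "(\<exists>n P d \<epsilon>. proj_resolution R (F M) n P d \<epsilon>) \<longleftrightarrow>
    factorization_ideal C T M = {Zer C (ShO C T) (ShO C T)}"
  proof
    assume "\<exists>n P d \<epsilon>. proj_resolution R (F M) n P d \<epsilon>"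
    then obtain K T0 k a w where "T0 \<in> add_obj C T" "dist_triangle C K T0 M k a w" "T_mono K T0 k"
      using T_mono_if_resolution[OF assms(3-5)] by blast
    then show "factorization_ideal C T M = {Zer C (ShO C T) (ShO C T)}"
      using factorization_zero_if_T_mono factorization_ideal_zero_iff[OF M] by blast
  next
    assume I: "factorization_ideal C T M = {Zer C (ShO C T) (ShO C T)}"
    obtain T0 K k a w where p: "T0 \<in> add_obj C T" "K \<in> add_obj C T" "T_epi T0 M a"
      "dist_triangle C K T0 M k a w" using ex_presentation[OF M] .
    have "T_mono K T0 k"
      using T_mono_if_factorization_zero[OF p(2,4)] I factorization_ideal_zero_iff[OF M] by blast
    then show "\<exists>n P d \<epsilon>. proj_resolution R (F M) n P d \<epsilon>" using resolution_if_T_mono[OF p] by blast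
  qed
  then show ?thesis using proj_dim_eq_infinity_iff by blast
qed

end
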